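(* Let $k\ge1$ be an integer and let $(X,d)$ be a $\sigma$-compact doubling metric space. Assume $E\subset X$ is a Souslin set which is not $\sigma$-finite with respect to $\mathcal H^k$. Then $E$ contains a closed subset $F$ such that $0<\mathcal H^k(F)<\infty$ and $F$ is purely $k$-unrectifiable.
   Context: $\mathcal H^k$ denotes the $k$-dimensional Hausdorff measure on $(X,d)$. A metric space is doubling if there exists $M$ such that every ball of radius $r$ can be covered by at most $M$ balls of radius $r/2$. It is $\sigma$-compact if it is a countable union of compact subsets. Souslin sets are also called analytic sets. A set is $\mathcal H^k$-$\sigma$-finite if it is a countable union of sets of finite $\mathcal H^k$ measure. A set $F\subset X$ is purely $k$-unrectifiable if $\mathcal H^k(F\cap f(B))=0$ for every Borel set $B\subset\mathbb R^k$ and every Lipschitz map $f:B\to X$. *)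

theory Defs
  imports "HOL-Analysis.Analysis"
begin

(* The library function "diameter" is real-valued and meaningless on unbounded sets, so the
   diameter is taken in the extended nonnegative reals. *)

definition ediameter :: "'a::metric_space set \<Rightarrow> ennreal" where
  "ediameter A = (SUP x\<in>A. SUP y\<in>A. ennreal (dist x y))"

(* The empty set contributes 0 also for k = 0, where ediameter {} ^ k would be 1. *)

definition hausdorff_weight :: "nat \<Rightarrow> 'a::metric_space set \<Rightarrow> ennreal" where
  "hausdorff_weight k A = (if A = {} then 0 else ediameter A ^ k)"

definition hausdorff_premeasure :: "nat \<Rightarrow> real \<Rightarrow> 'a::metric_space set \<Rightarrow> ennreal" where
  "hausdorff_premeasure k \<delta> S =
     Inf {(\<Sum>i. hausdorff_weight k (A i)) | A :: nat \<Rightarrow> 'a set.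
            S \<subseteq> (\<Union>i. A i) \<and> (\<forall>i. ediameter (A i) \<le> ennreal \<delta>)}"

(* The k-dimensional Hausdorff (outer) measure, defined on all subsets, without the normalizing
   constant that would make it agree with Lebesgue measure on Euclidean k-space. *)

definition hausdorff_measure :: "nat \<Rightarrow> 'a::metric_space set \<Rightarrow> ennreal" where
  "hausdorff_measure k S = (SUP \<delta>\<in>{0<..}. hausdorff_premeasure k \<delta> S)"

definition hausdorff_sigma_finite :: "nat \<Rightarrow> 'a::metric_space set \<Rightarrow> bool" where
  "hausdorff_sigma_finite k S \<longleftrightarrow>
     (\<exists>A :: nat \<Rightarrow> 'a set. S = (\<Union>i. A i) \<and> (\<forall>i. hausdorff_measure k (A i) < \<infinity>))"

definition doubling_space :: "'a::metric_space itself \<Rightarrow> bool" where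
  "doubling_space _ \<longleftrightarrow>
     (\<exists>M::nat. \<forall>(x::'a) r. 0 < r \<longrightarrow>
        (\<exists>C. finite C \<and> card C \<le> M \<and> ball x r \<subseteq> (\<Union>c\<in>C. ball c (r / 2))))"

definition sigma_compact :: "'a::topological_space set \<Rightarrow> bool" where
  "sigma_compact S \<longleftrightarrow> (\<exists>K :: nat \<Rightarrow> 'a set. (\<forall>i. compact (K i)) \<and> S = (\<Union>i. K i))"

(* The Souslin operation applied to a scheme of closed sets indexed by the finite nonempty
   initial segments of sequences of natural numbers. *)

definition souslin :: "'a::topological_space set \<Rightarrow> bool" where
  "souslin S \<longleftrightarrow>
     (\<exists>C :: nat list \<Rightarrow> 'a set. (\<forall>s. closed (C s)) \<and>
        S = (\<Union>\<sigma> :: nat \<Rightarrow> nat. \<Inter>n. C (map \<sigma> [0..<Suc n])))"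

(* Pure k-unrectifiability with k = CARD('n), Euclidean k-space being real ^ 'n. *)

definition purely_unrectifiable :: "'n::finite itself \<Rightarrow> 'a::metric_space set \<Rightarrow> bool" where
  "purely_unrectifiable _ F \<longleftrightarrow>
     (\<forall>B \<in> sets (borel :: (real ^ 'n) measure). \<forall>f :: real ^ 'n \<Rightarrow> 'a.
        (\<exists>L. L-lipschitz_on B f) \<longrightarrow> hausdorff_measure CARD('n) (F \<inter> f ` B) = 0)"

end

(* Write C(A) for the Hausdorff content of A modulo H^k-sigma-finite sets. It vanishes only on
   sigma-finite sets, and outside a sigma-finite subset every point x of A has arbitrarily small
   radii d with C(A \<inter> B(x, d)) \<ge> d^k / 2^(k+1).

   Call a finite family of disjoint balls B(x_i, d_i) admissible if each is isolated from the others
   up to a large multiple M of its radius and no ball of radius s contains more than L s^k of the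
   mass \<Sum> d_i^k. If C(A) is comparable to R^k, then A contains an admissible family of good balls with
   total mass exactly R^k. Indeed, select balls greedily in decreasing order of radius. If the total
   stays below R^k, then every point is close to a selected ball or lies in a ball that has reached
   its mass bound; the former points can be covered with a bounded sum of d^k at arbitrarily small
   scales, hence contribute only a set of finite measure, and the latter have content at most
   R^k / L up to a constant.

   Iterating with M tending to infinity, and following a Souslin scheme, gives a Cantor set F in E.
   Mass conservation bounds its measure from above, and the mass bound for balls bounds it from
   below. A Lipschitz preimage of F splits into pieces so far apart that disjoint balls of radius
   much larger than the diameters of the images surround them; comparing volumes in R^k shows that
   the image is a null set. *)

theory Submission
  imports Defs "HOL-Library.Diagonal_Subsequence"
begin

section \<open>Hausdorff measures and contents\<close>

text \<open>The obstacle is that the greedy family of a given starting scale may be infinite and the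
  saturated balls around it may be large, so no single family yields a fine cover. Only a limit over
  all starting scales separates a fixed cover of bounded weight from a remainder of finite measure.
  This is why the content has to ignore sigma-finite sets, and why the failure of sigma-finiteness,
  not merely infinite measure, is what is passed on. Good balls are chosen relative to the countably
  many Souslin pieces of a set, so that each ball already knows the next entry of its index
  sequence; no compact subset of large content has to be found first. Radii are powers of 1/2.
  Masses are therefore commensurable and can be made to add up exactly, and finite sums over the
  tree replace a limit measure. In the threshold \<open>d^k / 2^(k+1)\<close> the factor
  \<open>2^k\<close> pays for rounding a diameter up to a power of 1/2, and the other 2 is a genuine
  gain. For \<open>L\<close> one needs \<open>L - 1 > 12^k * 2^(k+1)\<close>, where 12 is twice the
  Vitali factor 6.\<close>

lemma Inf_cover_UN_le:
  fixes w :: "'b \<Rightarrow> ennreal" and P :: "nat \<Rightarrow> (nat \<Rightarrow> 'b) \<Rightarrow> bool"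
  assumes merge: "\<And>U. (\<And>n. P n (U n)) \<Longrightarrow> Q (\<lambda>i. case prod_decode i of (n, j) \<Rightarrow> U n j)"
  shows "Inf {(\<Sum>i. w (U i)) | U. Q U} \<le> (\<Sum>n. Inf {(\<Sum>i. w (U i)) | U. P n U})"
proof (rule ennreal_le_epsilon)
  let ?I = "\<lambda>n. Inf {(\<Sum>i. w (U i)) | U. P n U}"
  fix e :: real
  assume fin: "(\<Sum>n. ?I n) < top" and e: "0 < e"
  have lt: "a < a + b" if "a < top" "0 < b" for a b :: ennreal
    using that ennreal_add_left_cancel_less[of a 0 b] by auto
  \<comment> \<open>The usual geometric errors. \<open>P\<close> and \<open>Q\<close> stay abstract
    because the argument serves both the premeasure, where covers must be fine, and the content,
    where covers may miss a sigma-finite set.\<close>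
  have "\<exists>U. P n U \<and> (\<Sum>i. w (U i)) \<le> ?I n + ennreal (e * (1/2) ^ Suc n)" for n
  proof -
    have "?I n < top"
      using fin by (rule ennreal_suminf_lessD)
    moreover have "0 < ennreal (e * (1/2) ^ Suc n)"
      using e by simp
    ultimately have "?I n < ?I n + ennreal (e * (1/2) ^ Suc n)"
      by (rule lt)
    then show ?thesis
      unfolding Inf_less_iff by (blast intro: less_imp_le)
  qed
  then have "\<forall>n. \<exists>U. P n U \<and> (\<Sum>i. w (U i)) \<le> ?I n + ennreal (e * (1/2) ^ Suc n)"
    by (rule allI)
  from choice[OF this] obtain U where "\<forall>n. P n (U n) \<and>
      (\<Sum>i. w (U n i)) \<le> ?I n + ennreal (e * (1/2) ^ Suc n)"
    by (elim exE)
  then have U: "P n (U n)" "(\<Sum>i. w (U n i)) \<le> ?I n + ennreal (e * (1/2) ^ Suc n)" for n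
    by simp_all
  let ?f = "\<lambda>(n, j). w (U n j)"
  have "Inf {(\<Sum>i. w (U i)) | U. Q U} \<le> (\<Sum>i. w (case prod_decode i of (n, j) \<Rightarrow> U n j))"
    using merge[of U, OF U(1)]
    by (intro Inf_lower CollectI exI[of _ "\<lambda>i. case prod_decode i of (n, j) \<Rightarrow> U n j"] conjI refl)
  also have "\<dots> = (\<Sum>i. ?f (prod_decode i))"
    by (intro suminf_cong) (simp split: prod.split)
  also have "\<dots> = (\<Sum>n. \<Sum>j. w (U n j))"
    by (rule suminf_ennreal_2dimen) simp
  also have "\<dots> \<le> (\<Sum>n. ?I n + ennreal (e * (1/2) ^ Suc n))"
    by (intro suminf_le U) auto
  also have "\<dots> = (\<Sum>n. ?I n) + (\<Sum>n. ennreal (e * (1/2) ^ Suc n))"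
    by (intro suminf_add[symmetric]) auto
  also have "(\<Sum>n. ennreal (e * (1/2) ^ Suc n)) = ennreal e"
    using e sums_mult[OF power_half_series, of e] by (intro suminf_ennreal_eq) auto
  finally show "Inf {(\<Sum>i. w (U i)) | U. Q U} \<le> (\<Sum>n. ?I n) + ennreal e" .
qed

lemma UN_prod_decode: "(\<Union>i. case prod_decode i of (n, j) \<Rightarrow> U n j) = (\<Union>n. \<Union>j. U n j)"
proof (intro equalityI UN_least)
  show "(case prod_decode i of (n, j) \<Rightarrow> U n j) \<subseteq> (\<Union>n. \<Union>j. U n j)" for i
    by (cases "prod_decode i") auto
  show "U n j \<subseteq> (\<Union>i. case prod_decode i of (n, j) \<Rightarrow> U n j)" for n j
    using UN_upper[of "prod_encode (n, j)" UNIV "\<lambda>i. case prod_decode i of (n, j) \<Rightarrow> U n j"]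
    by simp
qed

text \<open>The definitions quantify over sequences, while the coverings built later are indexed by
  pairs or by disjoint sums. Bounded finite partial sums suffice, and \<open>w {} = 0\<close> allows
  padding by empty sets.\<close>

lemma countable_family_to_sequence:
  fixes f :: "'q \<Rightarrow> 'a set" and w :: "'a set \<Rightarrow> ennreal"
  assumes "countable Q" and "w {} = 0"
    and fin: "\<And>Q'. finite Q' \<Longrightarrow> Q' \<subseteq> Q \<Longrightarrow> (\<Sum>q\<in>Q'. w (f q)) \<le> M"
  obtains U :: "nat \<Rightarrow> 'a set" where "(\<Union>i. U i) = (\<Union>q\<in>Q. f q)"
    "\<And>i. U i = {} \<or> U i \<in> f ` Q" "(\<Sum>i. w (U i)) \<le> M"
proof
  let ?g = "to_nat_on Q"
  define U where "U i = (if i \<in> ?g ` Q then f (from_nat_into Q i) else {})" for i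
  have inj: "inj_on ?g Q" using assms(1) by (rule inj_on_to_nat_on)
  have Ug: "U (?g q) = f q" if "q \<in> Q" for q
    using that assms(1) by (simp add: U_def)
  have U0: "U i = {}" if "i \<notin> ?g ` Q" for i
    using that by (simp add: U_def)
  show "(\<Union>i. U i) = (\<Union>q\<in>Q. f q)"
  proof (intro equalityI UN_least)
    show "U i \<subseteq> (\<Union>q\<in>Q. f q)" for i
      using Ug U0[of i] by (cases "i \<in> ?g ` Q") auto
    show "f q \<subseteq> (\<Union>i. U i)" if "q \<in> Q" for q
      unfolding Ug[OF that, symmetric] by blast
  qed
  show "U i = {} \<or> U i \<in> f ` Q" for i
    using Ug U0 by (cases "i \<in> ?g ` Q") auto
  have "(\<Sum>i<n. w (U i)) \<le> M" for n
  proof -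
    let ?Q = "{q \<in> Q. ?g q < n}"
    have fQ: "finite ?Q"
      by (rule inj_on_finite[of ?g _ "{..<n}"]) (auto intro: inj_on_subset[OF inj])
    have "(\<Sum>i<n. w (U i)) = (\<Sum>i\<in>?g ` ?Q. w (U i))"
    proof (intro sum.mono_neutral_right ballI)
      fix i assume "i \<in> {..<n} - ?g ` ?Q"
      then have "i \<notin> ?g ` Q" by auto
      then show "w (U i) = 0" using U0 assms(2) by simp
    qed auto
    also have "\<dots> = (\<Sum>q\<in>?Q. w (f q))"
      by (subst sum.reindex) (auto intro: inj_on_subset[OF inj] intro!: sum.cong simp: Ug)
    also have "\<dots> \<le> M" using fin[OF fQ] by auto
    finally show ?thesis .
  qed
  then show "(\<Sum>i. w (U i)) \<le> M"
    by (intro suminf_le_const) auto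
qed

section \<open>Diameters, Hausdorff premeasure and measure\<close>

lemma dist_le_ediameter: "x \<in> A \<Longrightarrow> y \<in> A \<Longrightarrow> ennreal (dist x y) \<le> ediameter A"
  unfolding ediameter_def by (meson SUP_upper2 order_refl)

lemma ediameter_le: "(\<And>x y. x \<in> A \<Longrightarrow> y \<in> A \<Longrightarrow> dist x y \<le> r) \<Longrightarrow> ediameter A \<le> ennreal r"
  unfolding ediameter_def by (intro SUP_least ennreal_leI) auto

lemma ediameter_mono: "A \<subseteq> B \<Longrightarrow> ediameter A \<le> ediameter B"
  unfolding ediameter_def by (intro SUP_mono) (meson SUP_subset_mono order_refl subsetD)

lemma hausdorff_weight_empty [simp]: "hausdorff_weight k {} = 0"
  by (simp add: hausdorff_weight_def)

lemma hausdorff_weight_mono: "A \<subseteq> B \<Longrightarrow> hausdorff_weight k A \<le> hausdorff_weight k B"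
  unfolding hausdorff_weight_def by (auto intro: power_mono ediameter_mono)

lemma hausdorff_weight_le:
  assumes "\<And>x y. x \<in> A \<Longrightarrow> y \<in> A \<Longrightarrow> dist x y \<le> r" "0 \<le> r"
  shows "hausdorff_weight k A \<le> ennreal (r ^ k)"
proof -
  have "ediameter A ^ k \<le> ennreal r ^ k"
    by (intro power_mono ediameter_le assms) auto
  then show ?thesis
    using assms(2) by (simp add: hausdorff_weight_def ennreal_power)
qed

lemma hausdorff_premeasure_le:
  assumes "S \<subseteq> (\<Union>i. A i)" "\<And>i. ediameter (A i) \<le> ennreal \<delta>"
  shows "hausdorff_premeasure k \<delta> S \<le> (\<Sum>i. hausdorff_weight k (A i))"
  unfolding hausdorff_premeasure_def using assms by (intro Inf_lower) blast

lemma hausdorff_premeasure_le_family: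
  assumes "countable Q" "S \<subseteq> (\<Union>q\<in>Q. f q)" "\<And>q. q \<in> Q \<Longrightarrow> ediameter (f q) \<le> ennreal \<delta>"
    and "\<And>Q'. finite Q' \<Longrightarrow> Q' \<subseteq> Q \<Longrightarrow> (\<Sum>q\<in>Q'. hausdorff_weight k (f q)) \<le> M"
  shows "hausdorff_premeasure k \<delta> S \<le> M"
proof -
  obtain U where U: "(\<Union>i. U i) = (\<Union>q\<in>Q. f q)" "\<And>i. U i = {} \<or> U i \<in> f ` Q"
    "(\<Sum>i. hausdorff_weight k (U i)) \<le> M"
    using countable_family_to_sequence[OF assms(1) hausdorff_weight_empty assms(4)] by metis
  have "ediameter (U i) \<le> ennreal \<delta>" for i
    using U(2)[of i] assms(3) by (auto simp: ediameter_def bot_ennreal)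
  then show ?thesis
    using hausdorff_premeasure_le[of S U \<delta> k] U assms(2) by (metis order_trans)
qed

lemma hausdorff_premeasure_mono:
  "S \<subseteq> T \<Longrightarrow> hausdorff_premeasure k \<delta> S \<le> hausdorff_premeasure k \<delta> T"
  unfolding hausdorff_premeasure_def by (rule Inf_superset_mono) blast

lemma hausdorff_premeasure_UN_le:
  "hausdorff_premeasure k \<delta> (\<Union>n. S n) \<le> (\<Sum>n. hausdorff_premeasure k \<delta> (S n))"
  unfolding hausdorff_premeasure_def
proof (rule Inf_cover_UN_le)
  fix U :: "nat \<Rightarrow> nat \<Rightarrow> 'a set"
  assume U: "S n \<subseteq> (\<Union>i. U n i) \<and> (\<forall>i. ediameter (U n i) \<le> ennreal \<delta>)" for n
  have "(\<Union>n. S n) \<subseteq> (\<Union>i. case prod_decode i of (n, j) \<Rightarrow> U n j)"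
    unfolding UN_prod_decode using U by (intro UN_mono) auto
  then show "(\<Union>n. S n) \<subseteq> (\<Union>i. case prod_decode i of (n, j) \<Rightarrow> U n j) \<and>
     (\<forall>i. ediameter (case prod_decode i of (n, j) \<Rightarrow> U n j) \<le> ennreal \<delta>)"
    using U by (simp split: prod.split)
qed

lemma hausdorff_measure_mono: "S \<subseteq> T \<Longrightarrow> hausdorff_measure k S \<le> hausdorff_measure k T"
  unfolding hausdorff_measure_def
  by (rule SUP_mono) (rule bexI, erule hausdorff_premeasure_mono, assumption)

lemma hausdorff_measure_le:
  assumes "\<And>\<delta>. 0 < \<delta> \<Longrightarrow> hausdorff_premeasure k \<delta> S \<le> M"
  shows "hausdorff_measure k S \<le> M"
  unfolding hausdorff_measure_def using assms by (intro SUP_least) auto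

lemma hausdorff_premeasure_le_measure: "0 < \<delta> \<Longrightarrow> hausdorff_premeasure k \<delta> S \<le> hausdorff_measure k S"
  unfolding hausdorff_measure_def by (intro SUP_upper) auto

lemma hausdorff_measure_UN_null:
  assumes "\<And>n::nat. hausdorff_measure k (S n) = 0"
  shows "hausdorff_measure k (\<Union>n. S n) = 0"
proof -
  have "hausdorff_premeasure k \<delta> (S n) = 0" if "0 < \<delta>" for \<delta> n
    using hausdorff_premeasure_le_measure[OF that, of k "S n"] assms by simp
  then have "hausdorff_premeasure k \<delta> (\<Union>n. S n) \<le> 0" if "0 < \<delta>" for \<delta>
    using hausdorff_premeasure_UN_le[of k \<delta> S] that by simp
  then show ?thesis
    using hausdorff_measure_le[of k _ 0] by (metis le_zero_eq)
qed

lemma hausdorff_measure_singleton: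
  assumes "0 < k" shows "hausdorff_measure k {x} = 0"
proof -
  have "hausdorff_premeasure k \<delta> {x} \<le> 0" if "0 < \<delta>" for \<delta>
  proof -
    have "hausdorff_weight k {x} = 0" "ediameter {x} = 0"
      using assms by (auto simp: hausdorff_weight_def ediameter_def)
    then show ?thesis
      using hausdorff_premeasure_le_family[of "{x}" "{x}" "\<lambda>x. {x}" \<delta> k 0]
      by (auto dest: subset_singletonD)
  qed
  then show ?thesis
    using hausdorff_measure_le[of k _ 0] by (metis le_zero_eq)
qed

section \<open>Sigma-finite sets\<close>

lemma hausdorff_sigma_finite_subset_UN:
  assumes "S \<subseteq> (\<Union>n::nat. A n)" "\<And>n. hausdorff_sigma_finite k (A n)"
  shows "hausdorff_sigma_finite k S"
proof -
  obtain B where B: "\<And>n. A n = (\<Union>i::nat. B n i)" "\<And>n i. hausdorff_measure k (B n i) < \<infinity>"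
    using assms(2) unfolding hausdorff_sigma_finite_def by metis
  \<comment> \<open>\<open>hausdorff_sigma_finite\<close> asks for an exact decomposition, so the
    pieces are cut down to \<open>S\<close>.\<close>
  let ?D = "\<lambda>i. S \<inter> (case prod_decode i of (n, j) \<Rightarrow> B n j)"
  have "S = (\<Union>i. ?D i)"
    unfolding Int_UN_distrib[symmetric] UN_prod_decode using assms(1) B(1) by auto
  moreover have "hausdorff_measure k (?D i) < \<infinity>" for i
    using B(2) hausdorff_measure_mono[of "?D i" "case prod_decode i of (n, j) \<Rightarrow> B n j" k]
    by (auto split: prod.splits intro: le_less_trans)
  ultimately show ?thesis
    unfolding hausdorff_sigma_finite_def by blast
qed

lemma hausdorff_sigma_finite_subset:
  "S \<subseteq> T \<Longrightarrow> hausdorff_sigma_finite k T \<Longrightarrow> hausdorff_sigma_finite k S"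
  using hausdorff_sigma_finite_subset_UN[of S "\<lambda>_. T"] by simp

lemma hausdorff_sigma_finite_Un:
  assumes "hausdorff_sigma_finite k S" "hausdorff_sigma_finite k T"
  shows "hausdorff_sigma_finite k (S \<union> T)"
  by (rule hausdorff_sigma_finite_subset_UN[of _ "\<lambda>n. if n = 0 then S else T"])
    (use assms in \<open>auto split: if_splits\<close>)

lemma hausdorff_sigma_finite_if_finite:
  "hausdorff_measure k S < \<infinity> \<Longrightarrow> hausdorff_sigma_finite k S"
  unfolding hausdorff_sigma_finite_def by (intro exI[of _ "\<lambda>_. S"]) auto

lemma hausdorff_sigma_finite_if_null:
  "hausdorff_measure k S \<le> 0 \<Longrightarrow> hausdorff_sigma_finite k S"
  by (rule hausdorff_sigma_finite_if_finite) auto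

text \<open>Since \<open>\<sigma>\<close>-finite sets are discarded before covering, this content differs from zero only for
  sets that are not \<open>\<sigma>\<close>-finite.\<close>

definition sigma_content :: "nat \<Rightarrow> 'a::metric_space set \<Rightarrow> ennreal" where
  "sigma_content k A =
     Inf {(\<Sum>i. hausdorff_weight k (U i)) | U :: nat \<Rightarrow> 'a set.
            hausdorff_sigma_finite k (A - (\<Union>i. U i))}"

lemma sigma_content_le:
  "hausdorff_sigma_finite k (A - (\<Union>i. U i)) \<Longrightarrow> sigma_content k A \<le> (\<Sum>i. hausdorff_weight k (U i))"
  unfolding sigma_content_def by (intro Inf_lower) blast

lemma sigma_content_le_family:
  assumes "countable Q" "hausdorff_sigma_finite k (A - (\<Union>q\<in>Q. f q))"
    and "\<And>Q'. finite Q' \<Longrightarrow> Q' \<subseteq> Q \<Longrightarrow> (\<Sum>q\<in>Q'. hausdorff_weight k (f q)) \<le> M"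
  shows "sigma_content k A \<le> M"
proof -
  obtain U where "(\<Union>i. U i) = (\<Union>q\<in>Q. f q)" "(\<Sum>i. hausdorff_weight k (U i)) \<le> M"
    using countable_family_to_sequence[OF assms(1) hausdorff_weight_empty assms(3)] by metis
  then show ?thesis
    using sigma_content_le[of k A U] assms(2) by (metis order_trans)
qed

lemma sigma_content_mono: "A \<subseteq> B \<Longrightarrow> sigma_content k A \<le> sigma_content k B"
  unfolding sigma_content_def
  by (rule Inf_superset_mono) (blast intro: hausdorff_sigma_finite_subset)

lemma sigma_content_le_weight: "sigma_content k A \<le> hausdorff_weight k A"
proof -
  have "hausdorff_premeasure k \<delta> {} \<le> 0" for \<delta>
    by (rule hausdorff_premeasure_le_family[of "{}" _ "\<lambda>x. x"]) auto
  then have "hausdorff_measure k {} \<le> 0"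
    by (rule hausdorff_measure_le)
  then have "hausdorff_sigma_finite k {}"
    by (rule hausdorff_sigma_finite_if_null)
  then show ?thesis
    by (intro sigma_content_le_family[of "{A}" k A "\<lambda>x. x"]) (auto dest: subset_singletonD)
qed

lemma sigma_content_zero_if_sigma_finite:
  "hausdorff_sigma_finite k A \<Longrightarrow> sigma_content k A = 0"
  using sigma_content_le_family[of "{}" k A "\<lambda>x. x" 0] by simp

lemma sigma_content_UN_le: "sigma_content k (\<Union>n. S n) \<le> (\<Sum>n. sigma_content k (S n))"
  unfolding sigma_content_def
proof (rule Inf_cover_UN_le)
  fix U :: "nat \<Rightarrow> nat \<Rightarrow> 'a set"
  assume U: "hausdorff_sigma_finite k (S n - (\<Union>i. U n i))" for n
  have "(\<Union>n. S n) - (\<Union>i. case prod_decode i of (n, j) \<Rightarrow> U n j) \<subseteq> (\<Union>n. S n - (\<Union>i. U n i))"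
    unfolding UN_prod_decode by auto
  then show "hausdorff_sigma_finite k ((\<Union>n. S n) - (\<Union>i. case prod_decode i of (n, j) \<Rightarrow> U n j))"
    using U by (rule hausdorff_sigma_finite_subset_UN)
qed

text \<open>Covers of total weight tending to 0 leave countably many sigma-finite remainders. What
  lies in all of the covers is a null set: the content does not restrict diameters, but for
  \<open>k > 0\<close> a small weight forces a small diameter.\<close>

lemma sigma_finite_if_sigma_content_zero:
  assumes "sigma_content k A = 0" "0 < k"
  shows "hausdorff_sigma_finite k A"
proof -
  have "\<exists>U :: nat \<Rightarrow> 'a set. hausdorff_sigma_finite k (A - (\<Union>i. U i)) \<and>
      (\<Sum>i. hausdorff_weight k (U i)) < ennreal ((1 / 2 ^ n) ^ k)" for n :: nat
  proof -
    have "0 < ennreal ((1 / 2 ^ n) ^ k)" by simp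
    then show ?thesis
      unfolding assms(1)[symmetric] sigma_content_def Inf_less_iff by blast
  qed
  then have "\<forall>n. \<exists>U :: nat \<Rightarrow> 'a set. hausdorff_sigma_finite k (A - (\<Union>i. U i)) \<and>
      (\<Sum>i. hausdorff_weight k (U i)) < ennreal ((1 / 2 ^ n) ^ k)"
    by (rule allI)
  from choice[OF this] obtain U :: "nat \<Rightarrow> nat \<Rightarrow> 'a set" where
    "\<forall>n. hausdorff_sigma_finite k (A - (\<Union>i. U n i)) \<and>
       (\<Sum>i. hausdorff_weight k (U n i)) < ennreal ((1 / 2 ^ n) ^ k)"
    by (elim exE)
  then have U: "hausdorff_sigma_finite k (A - (\<Union>i. U n i))"
    "(\<Sum>i. hausdorff_weight k (U n i)) < ennreal ((1 / 2 ^ n) ^ k)" for n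
    by simp_all
  let ?Z = "\<Inter>n. \<Union>i. U n i"
  have small: "\<forall>\<^sub>F n in sequentially. (1 / 2 ^ n :: real) ^ k \<le> min e (e ^ k)" if "0 < e" for e
  proof -
    have "(\<lambda>n. (1 / 2 ^ n :: real) ^ k) \<longlonglongrightarrow> 0 ^ k"
      by (intro tendsto_power LIMSEQ_inverse_realpow_zero[of 2, unfolded inverse_eq_divide]) auto
    moreover have "0 ^ k < min e (e ^ k)"
      using assms(2) that by (simp add: zero_power)
    ultimately show ?thesis
      by (rule eventually_mono[OF order_tendstoD(2)]) (rule less_imp_le)
  qed
  have "hausdorff_premeasure k \<delta> ?Z \<le> ennreal e" if pos: "0 < \<delta>" "0 < e" for \<delta> e
  proof -
    obtain n where n: "(1 / 2 ^ n :: real) ^ k \<le> \<delta> ^ k" "(1 / 2 ^ n :: real) ^ k \<le> e"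
      using eventually_happens[OF eventually_conj[OF small[OF pos(1)] small[OF pos(2)]]]
      by (auto simp del: power_mono_iff)
    have "ediameter (U n i) \<le> ennreal \<delta>" for i
    proof (rule ccontr)
      assume "\<not> ?thesis"
      then have less: "ennreal \<delta> < ediameter (U n i)" by simp
      then have "U n i \<noteq> {}" by (auto simp: ediameter_def bot_ennreal)
      then have "ennreal \<delta> ^ k \<le> hausdorff_weight k (U n i)"
        using less unfolding hausdorff_weight_def by (auto intro!: power_mono)
      also have "\<dots> \<le> (\<Sum>i. hausdorff_weight k (U n i))"
        using sum_le_suminf[of "\<lambda>i. hausdorff_weight k (U n i)" "{i}"] by auto
      also have "\<dots> < ennreal ((1 / 2 ^ n) ^ k)" by (rule U)
      also have "\<dots> \<le> ennreal (\<delta> ^ k)" using n by (intro ennreal_leI)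
      finally show False using pos by (simp add: ennreal_power)
    qed
    then have "hausdorff_premeasure k \<delta> ?Z \<le> (\<Sum>i. hausdorff_weight k (U n i))"
      by (intro hausdorff_premeasure_le) auto
    also have "\<dots> \<le> ennreal e"
      using U(2)[of n] n(2) by (meson ennreal_leI less_imp_le order_trans)
    finally show ?thesis .
  qed
  then have "hausdorff_premeasure k \<delta> ?Z \<le> 0" if "0 < \<delta>" for \<delta>
    using that ennreal_le_epsilon[of 0] by (metis add_0)
  then have "hausdorff_measure k ?Z \<le> 0" by (rule hausdorff_measure_le)
  then have "hausdorff_sigma_finite k ?Z"
    by (rule hausdorff_sigma_finite_if_null)
  moreover have "hausdorff_sigma_finite k (\<Union>n. A - (\<Union>i. U n i))"
    using U(1) by (intro hausdorff_sigma_finite_subset_UN[OF order_refl])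
  ultimately show ?thesis
    by (rule hausdorff_sigma_finite_subset[rotated, OF hausdorff_sigma_finite_Un]) auto
qed

section \<open>Density\<close>

definition dyad :: "nat \<Rightarrow> real" where "dyad n = (1 / 2) ^ n"

lemma dyad_pos [simp]: "0 < dyad n" and dyad_nonneg [simp]: "0 \<le> dyad n"
  by (simp_all add: dyad_def)

lemma dyad_Suc: "dyad (Suc n) = dyad n / 2"
  by (simp add: dyad_def)

lemma dyad_antimono: "m \<le> n \<Longrightarrow> dyad n \<le> dyad m"
  unfolding dyad_def by (intro power_decreasing) auto

lemma dyad_less: "m < n \<Longrightarrow> 2 * dyad n \<le> dyad m"
  using dyad_antimono[of "Suc m" n] by (simp add: dyad_Suc)

lemma dyad_tendsto_0: "dyad \<longlonglongrightarrow> 0"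
  unfolding dyad_def by (rule LIMSEQ_realpow_zero) auto

lemma eventually_dyad_le:
  assumes "0 < e" shows "\<forall>\<^sub>F n in sequentially. c * dyad n \<le> e"
proof -
  have "(\<lambda>n. c * dyad n) \<longlonglongrightarrow> c * 0"
    by (intro tendsto_mult_left dyad_tendsto_0)
  then show ?thesis
    using assms by (auto dest!: order_tendstoD(2)[of _ _ _ e] elim!: eventually_mono)
qed

lemma dyad_bracket:
  assumes "0 < D" "D \<le> dyad m"
  obtains n where "m \<le> n" "D \<le> dyad n" "dyad n < 2 * D"
proof -
  let ?P = "\<lambda>n. m \<le> n \<and> dyad n < 2 * D"
  obtain n0 where n0: "\<And>n. n0 \<le> n \<Longrightarrow> 1 * dyad n \<le> D"
    using eventually_dyad_le[OF assms(1), of 1] unfolding eventually_sequentially by blast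
  have "1 * dyad (max m n0) \<le> D" by (rule n0) simp
  then have ex: "?P (max m n0)" using assms(1) by simp
  define n where "n = (LEAST n. ?P n)"
  have n: "?P n" unfolding n_def by (rule LeastI[of ?P, OF ex])
  have "D \<le> dyad n"
  proof (cases "n = m")
    case True then show ?thesis using assms by simp
  next
    case False
    then obtain l where l: "n = Suc l" "m \<le> l" using n by (cases n) auto
    then have "\<not> ?P l" using not_less_Least[of l ?P] unfolding n_def[symmetric] by simp
    then show ?thesis using l by (simp add: dyad_Suc)
  qed
  then show ?thesis using that n by blast
qed

lemma hausdorff_sigma_finite_UN_finite:
  assumes "finite Y" "\<And>y. y \<in> Y \<Longrightarrow> hausdorff_sigma_finite k (f y)"
  shows "hausdorff_sigma_finite k (\<Union>y\<in>Y. f y)"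
  using assms
proof (induction Y)
  case empty
  have "hausdorff_premeasure k \<delta> {} \<le> 0" for \<delta>
    by (rule hausdorff_premeasure_le_family[of "{}" _ "\<lambda>x. x"]) auto
  then have "hausdorff_sigma_finite k {}"
    by (intro hausdorff_sigma_finite_if_null hausdorff_measure_le)
  then show ?case by simp
qed (simp add: hausdorff_sigma_finite_Un)

lemma sigma_content_Un_null:
  assumes "hausdorff_sigma_finite k N"
  shows "sigma_content k (A \<union> N) \<le> sigma_content k A"
  unfolding sigma_content_def
proof (rule Inf_superset_mono, safe)
  fix U :: "nat \<Rightarrow> 'a set"
  assume "hausdorff_sigma_finite k (A - (\<Union>i. U i))"
  from hausdorff_sigma_finite_Un[OF this assms]
  have "hausdorff_sigma_finite k (A \<union> N - (\<Union>i. U i))"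
    by (rule hausdorff_sigma_finite_subset[rotated]) auto
  then show "\<exists>Ua. (\<Sum>i. hausdorff_weight k (U i)) = (\<Sum>i. hausdorff_weight k (Ua i)) \<and>
      hausdorff_sigma_finite k (A \<union> N - (\<Union>i. Ua i))" by blast
qed

text \<open>A set of points at which \<open>A\<close> has low upper density would have a content at most half of
  itself, since every set of a cover can be replaced by a ball centred at one of its points.\<close>

lemma sigma_finite_low_density:
  fixes A :: "'a::metric_space set"
  assumes K: "compact K" "A \<subseteq> K" and k: "0 < k"
  shows "hausdorff_sigma_finite k {x \<in> A. \<not> (\<forall>m. \<exists>n\<ge>m.
    ennreal (dyad n ^ k / 2 ^ Suc k) \<le> sigma_content k (A \<inter> cball x (dyad n)))}"
proof -
  let ?low = "\<lambda>n. ennreal (dyad n ^ k / 2 ^ Suc k)"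
  define Z where "Z m = {x \<in> A. \<forall>n\<ge>m. sigma_content k (A \<inter> cball x (dyad n)) < ?low n}" for m
  \<comment> \<open>A set of diameter \<open>D > 0\<close> in \<open>Z m\<close> lies in a ball
    about one of its own points, of dyadic radius in \<open>[D, 2 * D)\<close>. The
    \<open>2 ^ k\<close> in \<open>?low\<close> pays for the rounding, and the remaining 2 is the
    gain.\<close>
  have half: "2 * sigma_content k V \<le> hausdorff_weight k V"
    if V: "V \<subseteq> Z m \<inter> ball y (dyad (Suc m))" for V m y
  proof (cases "V = {}")
    case True
    then show ?thesis using sigma_content_le_weight[of k V] by simp
  next
    case False
    then obtain x where x: "x \<in> V" by blast
    have dm: "dist u v \<le> dyad m" if "u \<in> V" "v \<in> V" for u v
    proof -
      have "dist y u < dyad (Suc m)" "dist y v < dyad (Suc m)" using that V by auto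
      then show ?thesis using dist_triangle[of u v y] by (simp add: dyad_Suc dist_commute)
    qed
    then have "ediameter V \<le> ennreal (dyad m)" by (rule ediameter_le)
    then obtain D where D: "ediameter V = ennreal D" "0 \<le> D" "D \<le> dyad m"
      by (cases "ediameter V") (auto simp: top_unique)
    have dD: "dist u v \<le> D" if "u \<in> V" "v \<in> V" for u v
      using dist_le_ediameter[OF that] D by simp
    show ?thesis
    \<comment> \<open>A singleton has no dyadic radius comparable to its diameter, but it is a null
      set.\<close>
    proof (cases "D = 0")
      case True
      then have "V = {x}" using dD x by fastforce
      then have "hausdorff_sigma_finite k V"
        using hausdorff_measure_singleton[OF k, of x] by (intro hausdorff_sigma_finite_if_null) simp
      then show ?thesis by (simp add: sigma_content_zero_if_sigma_finite)
    next
      case False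
      then have "0 < D" using D(2) by simp
      then obtain n where n: "m \<le> n" "D \<le> dyad n" "dyad n < 2 * D"
        using D(3) dyad_bracket by blast
      have "V \<subseteq> A \<inter> cball x (dyad n)"
        using V dD[OF x] n(2) unfolding Z_def by (fastforce simp: mem_cball)
      then have "sigma_content k V \<le> sigma_content k (A \<inter> cball x (dyad n))"
        by (rule sigma_content_mono)
      also have "\<dots> \<le> ?low n"
        using x V n(1) unfolding Z_def by (intro less_imp_le) blast
      finally have "2 * sigma_content k V \<le> 2 * ?low n" by (rule mult_left_mono) simp
      also have "\<dots> = ennreal 2 * ?low n" by simp
      also have "\<dots> = ennreal (2 * (dyad n ^ k / 2 ^ Suc k))"
        by (subst ennreal_mult) auto
      also have "\<dots> \<le> ennreal (D ^ k)"
      proof (rule ennreal_leI)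
        have "dyad n ^ k \<le> (2 * D) ^ k" using n(3) by (intro power_mono) auto
        then show "2 * (dyad n ^ k / 2 ^ Suc k) \<le> D ^ k"
          by (simp add: power_mult_distrib field_simps)
      qed
      also have "\<dots> = hausdorff_weight k V"
        using D \<open>V \<noteq> {}\<close> by (simp add: hausdorff_weight_def ennreal_power)
      finally show ?thesis .
    qed
  qed
  \<comment> \<open>In a ball of radius \<open>dyad (Suc m)\<close> every piece of a cover has
    diameter at most \<open>dyad m\<close>, so \<open>half\<close> applies to it and gives
    \<open>2 * s <= s\<close> for the content \<open>s\<close>. The ball also makes \<open>s\<close>
    finite, which forces \<open>s = 0\<close>.\<close>
  have "sigma_content k (Z m \<inter> ball y (dyad (Suc m))) = 0" for m y
  proof -
    let ?Z = "Z m \<inter> ball y (dyad (Suc m))"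
    let ?s = "sigma_content k ?Z"
    have "2 * ?s \<le> (\<Sum>i. hausdorff_weight k (U i))"
      if U: "hausdorff_sigma_finite k (?Z - (\<Union>i. U i))" for U :: "nat \<Rightarrow> 'a set"
    proof -
      have "?Z = (\<Union>i. U i \<inter> ?Z) \<union> (?Z - (\<Union>i. U i))" by blast
      then have "?s \<le> sigma_content k (\<Union>i. U i \<inter> ?Z)"
        using sigma_content_Un_null[OF U] by metis
      also have "\<dots> \<le> (\<Sum>i. sigma_content k (U i \<inter> ?Z))" by (rule sigma_content_UN_le)
      finally have "2 * ?s \<le> 2 * (\<Sum>i. sigma_content k (U i \<inter> ?Z))"
        by (rule mult_left_mono) simp
      also have "\<dots> = (\<Sum>i. 2 * sigma_content k (U i \<inter> ?Z))" by simp
      also have "\<dots> \<le> (\<Sum>i. hausdorff_weight k (U i))"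
      proof (intro suminf_le)
        fix i
        have "2 * sigma_content k (U i \<inter> ?Z) \<le> hausdorff_weight k (U i \<inter> ?Z)"
          by (rule half) blast
        also have "\<dots> \<le> hausdorff_weight k (U i)" by (rule hausdorff_weight_mono) blast
        finally show "2 * sigma_content k (U i \<inter> ?Z) \<le> hausdorff_weight k (U i)" .
      qed auto
      finally show ?thesis .
    qed
    then have "2 * ?s \<le> ?s"
      unfolding sigma_content_def[of k ?Z] by (intro Inf_greatest) blast
    moreover have "?s < top"
    proof -
      have "?s \<le> hausdorff_weight k ?Z" by (rule sigma_content_le_weight)
      also have "\<dots> \<le> ennreal (dyad m ^ k)"
      proof (rule hausdorff_weight_le)
        fix u v assume "u \<in> ?Z" "v \<in> ?Z"
        then have "dist y u < dyad (Suc m)" "dist y v < dyad (Suc m)" by auto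
        then show "dist u v \<le> dyad m"
          using dist_triangle[of u v y] by (simp add: dyad_Suc dist_commute)
      qed simp
      finally show ?thesis by (simp add: le_less_trans)
    qed
    ultimately show ?thesis
      by (cases ?s) (auto simp flip: ennreal_mult ennreal_numeral)
  qed
  then have sf: "hausdorff_sigma_finite k (Z m \<inter> ball y (dyad (Suc m)))" for m y
    using k by (rule sigma_finite_if_sigma_content_zero)
  have "hausdorff_sigma_finite k (Z m)" for m
  proof -
    obtain Y where Y: "finite Y" "K \<subseteq> (\<Union>y\<in>Y. ball y (dyad (Suc m)))"
      using K(1) dyad_pos[of "Suc m"] unfolding compact_eq_totally_bounded by blast
    have "hausdorff_sigma_finite k (\<Union>y\<in>Y. Z m \<inter> ball y (dyad (Suc m)))"
      by (intro hausdorff_sigma_finite_UN_finite Y sf)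
    moreover have "Z m \<subseteq> (\<Union>y\<in>Y. Z m \<inter> ball y (dyad (Suc m)))"
      using Y(2) K(2) unfolding Z_def by blast
    ultimately show ?thesis by (rule hausdorff_sigma_finite_subset[rotated])
  qed
  moreover have "{x \<in> A. \<not> (\<forall>m. \<exists>n\<ge>m. ?low n \<le> sigma_content k (A \<inter> cball x (dyad n)))} \<subseteq> (\<Union>m. Z m)"
    unfolding Z_def not_le[symmetric] by blast
  ultimately show ?thesis
    by (rule hausdorff_sigma_finite_subset_UN[rotated])
qed

section \<open>Greedy packings\<close>

text \<open>All levels are listed in one sequence because natural numbers as indices serve both the
  well-founded greedy selection and the diagonal subsequence. Since each level is finite, agreement
  of two families on all coarse balls is a finite condition.\<close>

lemma compact_multiscale_net:
  fixes K :: "'a::metric_space set"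
  assumes "compact K" "K \<noteq> {}"
  obtains y :: "nat \<Rightarrow> 'a" and lev :: "nat \<Rightarrow> nat"
  where "\<And>m. finite {j. lev j \<le> m}"
    "\<And>m x. x \<in> K \<Longrightarrow> \<exists>j. lev j = m \<and> dist x (y j) < dyad m"
proof -
  have "\<forall>m. \<exists>N. finite N \<and> K \<subseteq> (\<Union>x\<in>N. ball x (dyad m))"
    using assms(1) dyad_pos unfolding compact_eq_totally_bounded by blast
  from choice[OF this] obtain N where
    N': "\<forall>m. finite (N m) \<and> K \<subseteq> (\<Union>x\<in>N m. ball x (dyad m))" by (elim exE)
  then have N: "finite (N m)" "K \<subseteq> (\<Union>x\<in>N m. ball x (dyad m))" for m by simp_all
  have Nne: "N m \<noteq> {}" for m using N(2)[of m] assms(2) by auto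
  define V where "V = Sigma UNIV N"
  have cV: "countable V" unfolding V_def by (intro countable_SIGMA countableI_type) (simp add: countable_finite N)
  have "fst ` V = UNIV" using Nne unfolding V_def fst_image_Sigma by blast
  then have "infinite V" by (metis finite_imageI infinite_UNIV_nat)
  then have bij: "bij_betw (from_nat_into V) UNIV V" using cV by (intro bij_betw_from_nat_into)
  let ?f = "from_nat_into V"
  show ?thesis
  proof (rule that[of "fst \<circ> ?f" "snd \<circ> ?f"])
    fix m
    have "?f j \<in> Sigma {..m} N" if "fst (?f j) \<le> m" for j
    proof -
      have "?f j \<in> Sigma UNIV N" using bij_betwE[OF bij] unfolding V_def by blast
      then show ?thesis using that by (cases "?f j") auto
    qed
    then have "{j. (fst \<circ> ?f) j \<le> m} \<subseteq> ?f -` (Sigma {..m} N)"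
      by auto
    moreover have "finite (?f -` (Sigma {..m} N))"
      using bij N(1) by (intro finite_vimageI finite_SigmaI) (auto simp: bij_betw_def)
    ultimately show "finite {j. (fst \<circ> ?f) j \<le> m}" by (rule finite_subset)
  next
    fix m x assume "x \<in> K"
    then obtain v where "v \<in> N m" "dist v x < dyad m" using N(2)[of m] by auto
    moreover obtain j where "?f j = (m, v)"
      using bij \<open>v \<in> N m\<close> unfolding bij_betw_def V_def by (metis UNIV_I imageE mem_Sigma_iff)
    ultimately show "\<exists>j. (fst \<circ> ?f) j = m \<and> dist x ((snd \<circ> ?f) j) < dyad m"
      by (intro exI[of _ j]) (simp add: dist_commute)
  qed
qed

text \<open>Greedy selection from an infinite index set by recursion along \<open>r\<close>, with
  \<open>R i j\<close> as the conflict between an earlier \<open>i\<close> and a later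
  \<open>j\<close>.\<close>

lemma wf_greedy_set:
  assumes "wf r"
  obtains S where "\<And>j. j \<in> S \<longleftrightarrow> (\<forall>i\<in>S. (i, j) \<in> r \<longrightarrow> \<not> R i j)"
proof -
  define f where "f = wfrec r (\<lambda>f j. \<forall>i. (i, j) \<in> r \<longrightarrow> f i \<longrightarrow> \<not> R i j)"
  have "f j \<longleftrightarrow> (\<forall>i. (i, j) \<in> r \<longrightarrow> f i \<longrightarrow> \<not> R i j)" for j
    unfolding f_def by (subst wfrec[OF assms]) (simp add: cut_apply)
  then show ?thesis by (intro that[of "Collect f"]) blast
qed

text \<open>Sequential compactness of the Cantor space of subsets of the naturals, by
  diagonalization.\<close>

lemma convergent_subsequence_of_sets:
  fixes X :: "nat \<Rightarrow> nat set"
  obtains r J where "strict_mono (r :: nat \<Rightarrow> nat)"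
    "\<And>i. \<forall>\<^sub>F n in sequentially. i \<in> X (r n) \<longleftrightarrow> i \<in> J"
proof -
  let ?P = "\<lambda>i (s :: nat \<Rightarrow> nat). \<exists>b. \<forall>n. (i \<in> X (s n)) = b"
  interpret subseqs ?P
  proof
    fix i and s :: "nat \<Rightarrow> nat"
    have "\<exists>b. infinite {n. (i \<in> X (s n)) = b}"
    proof (rule ccontr)
      assume "\<not> ?thesis"
      then have "finite ({n. (i \<in> X (s n)) = True} \<union> {n. (i \<in> X (s n)) = False})" by blast
      moreover have "{n. (i \<in> X (s n)) = True} \<union> {n. (i \<in> X (s n)) = False} = UNIV" by blast
      ultimately show False by (metis infinite_UNIV_nat)
    qed
    then obtain b where b: "infinite {n. (i \<in> X (s n)) = b}" by blast
    have "?P i (s \<circ> enumerate {n. (i \<in> X (s n)) = b})"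
      using enumerate_in_set[OF b] by auto
    with strict_mono_enumerate[OF b] have "strict_mono (enumerate {n. (i \<in> X (s n)) = b}) \<and>
        ?P i (s \<circ> enumerate {n. (i \<in> X (s n)) = b})"
      by (rule conjI)
    then show "\<exists>r'. strict_mono r' \<and> ?P i (s \<circ> r')"
      by (rule exI[of _ "enumerate {n. (i \<in> X (s n)) = b}"])
  qed
  have P: "?P i (diagseq \<circ> ((+) (Suc i)))" for i
  proof (rule diagseq_holds)
    fix r s :: "nat \<Rightarrow> nat" and n assume "?P n s"
    then obtain b where "\<And>m. (n \<in> X (s m)) = b" by blast
    then show "?P n (s \<circ> r)" by (intro exI[of _ b]) simp
  qed
  define b where "b i \<longleftrightarrow> i \<in> X (diagseq (Suc i))" for i
  have b: "(i \<in> X (diagseq (Suc i + n))) = b i" for i n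
  proof -
    obtain c where "\<And>m. (i \<in> X ((diagseq \<circ> ((+) (Suc i))) m)) = c" using P[of i] by blast
    from this[of n] this[of 0] show ?thesis unfolding b_def by simp
  qed
  show ?thesis
  proof (rule that[OF subseq_diagseq, of "{i. b i}"])
    fix i
    have "(i \<in> X (diagseq n)) = b i" if "Suc i \<le> n" for n
      using b[of i "n - Suc i"] that by simp
    then show "\<forall>\<^sub>F n in sequentially. i \<in> X (diagseq n) \<longleftrightarrow> i \<in> {i. b i}"
      unfolding eventually_sequentially by auto
  qed
qed

text \<open>All the masses are integer multiples of the smallest one, so a subfamily that is minimal among
  those of sufficient mass does not exceed the bound.\<close>

lemma exact_dyadic_subsum:
  fixes lv :: "'p \<Rightarrow> nat"
  assumes "finite I" "\<And>p. p \<in> I \<Longrightarrow> N \<le> lv p" "dyad N ^ k \<le> (\<Sum>p\<in>I. dyad (lv p) ^ k)"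
  obtains J where "J \<subseteq> I" "(\<Sum>p\<in>J. dyad (lv p) ^ k) = dyad N ^ k"
proof -
  let ?s = "\<lambda>J. \<Sum>p\<in>J. dyad (lv p) ^ k"
  let ?P = "\<lambda>J. J \<subseteq> I \<and> dyad N ^ k \<le> ?s J"
  obtain J where J: "?P J" "\<And>J'. ?P J' \<Longrightarrow> card J \<le> card J'"
    using ex_has_least_nat[of ?P I card] assms(3) by blast
  have fJ: "finite J" using J(1) assms(1) finite_subset by blast
  have "0 < dyad N ^ k" by simp
  then have "0 < ?s J" using J(1) by linarith
  then have "J \<noteq> {}" by auto
  then obtain p where p: "p \<in> J" "lv p = Max (lv ` J)"
    using Max_in[of "lv ` J"] fJ by (metis (no_types, lifting) finite_imageI imageE image_is_empty)
  have max: "lv q \<le> lv p" if "q \<in> J" for q using p(2) that fJ by simp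
  let ?e = "dyad (lv p) ^ k"
  have scale: "dyad n ^ k = ?e * real ((2 ^ (lv p - n)) ^ k)" if "n \<le> lv p" for n
  proof -
    have "dyad n = dyad (n + (lv p - n)) * 2 ^ (lv p - n)"
      by (simp add: dyad_def power_add flip: power_mult_distrib)
    then have "dyad n = dyad (lv p) * 2 ^ (lv p - n)" using that by simp
    then show ?thesis by (simp add: power_mult_distrib)
  qed
  define S X where "S = (\<Sum>q\<in>J. (2 ^ (lv p - lv q)) ^ k :: nat)"
    and "X = ((2 ^ (lv p - N)) ^ k :: nat)"
  have S: "?s J = ?e * real S"
    unfolding S_def of_nat_sum sum_distrib_left by (intro sum.cong refl scale max)
  have X: "dyad N ^ k = ?e * real X"
    unfolding X_def using assms(2) J(1) p(1) by (intro scale) auto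
  \<comment> \<open>By minimality, dropping the lightest member \<open>p\<close> brings the mass
    below the bound, so the excess of \<open>J\<close> is less than \<open>?e\<close>. Both sides
    are integer multiples of \<open>?e\<close>, hence there is no excess.\<close>
  have "\<not> ?P (J - {p})"
    using J(2)[of "J - {p}"] card_Diff1_less[OF fJ p(1)] by (metis not_le)
  then have "?s (J - {p}) < dyad N ^ k" using J(1) by auto
  then have "?s J < dyad N ^ k + ?e" using fJ p(1) by (simp add: sum_diff1)
  then have "?e * real S < ?e * (real X + 1)" unfolding S X by (simp add: distrib_left)
  then have "real S < real X + 1" by (subst (asm) mult_less_cancel_left_pos) auto
  then have "real S \<le> real X" by simp
  then have "?s J \<le> dyad N ^ k" unfolding S X by (intro mult_left_mono) auto
  then show ?thesis using that[of J] J(1) by simp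
qed

text \<open>A pair \<open>(x, n)\<close> stands for the ball of radius \<open>dyad n\<close> about \<open>x\<close>, to which the mass
  \<open>dyad n ^ k\<close> is given.\<close>

locale multiscale_packing =
  fixes k :: nat and M L :: real and y :: "nat \<Rightarrow> 'a::metric_space" and lev :: "nat \<Rightarrow> nat"
  assumes M_pos: "0 < M" and L_gt_1: "1 < L"
begin

text \<open>Reduces the mass bound for all balls to countably many tests. The factor 2 lets the
  neighbourhood of a suitable net point contain a given ball of radius \<open>dyad m\<close> about a
  point of the compact set. Coarser members are left out since one of them alone could exceed the
  bound.\<close>

definition near :: "nat \<Rightarrow> ('a \<times> nat) set" where
  "near j = {p. lev j \<le> snd p \<and> dist (fst p) (y j) < 2 * dyad (lev j)}"

definition mass :: "('a \<times> nat) set \<Rightarrow> real" where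
  "mass I = (\<Sum>p\<in>I. dyad (snd p) ^ k)"

definition admissible :: "('a \<times> nat) set \<Rightarrow> bool" where
  "admissible I \<longleftrightarrow>
     (\<forall>p\<in>I. \<forall>q\<in>I. p \<noteq> q \<longrightarrow> M * dyad (snd p) \<le> dist (fst p) (fst q)) \<and>
     (\<forall>j. mass (I \<inter> near j) \<le> L * dyad (lev j) ^ k)"

text \<open>The threshold is \<open>L - 1\<close> rather than \<open>L\<close>: a test ball that is
  not saturated has room for one more member, whose mass is at most \<open>dyad (lev j) ^ k\<close>.
  Finite subfamilies give the notion a meaning for infinite \<open>I\<close>.\<close>

definition saturated :: "('a \<times> nat) set \<Rightarrow> nat \<Rightarrow> bool" where
  "saturated I j \<longleftrightarrow> (\<exists>J. finite J \<and> J \<subseteq> I \<inter> near j \<and> (L - 1) * dyad (lev j) ^ k < mass J)"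

lemma mass_mono: "finite I \<Longrightarrow> J \<subseteq> I \<Longrightarrow> mass J \<le> mass I"
  unfolding mass_def by (rule sum_mono2) auto

lemma admissible_subset:
  assumes "admissible I" "finite I" "J \<subseteq> I"
  shows "admissible J"
proof -
  have "mass (J \<inter> near j) \<le> mass (I \<inter> near j)" for j
    using assms by (intro mass_mono) auto
  then have "mass (J \<inter> near j) \<le> L * dyad (lev j) ^ k" for j
    using assms(1) unfolding admissible_def by (meson order_trans)
  then show ?thesis
    using assms(1,3) unfolding admissible_def by blast
qed

lemma admissible_empty: "admissible {}"
  using L_gt_1 by (simp add: admissible_def mass_def)

text \<open>Since the members of \<open>I\<close> are at least as coarse as \<open>p\<close>, the
  separation conditions involving \<open>p\<close> are decided by their radii alone; and the mass
  bound can only fail at a test ball that contains \<open>p\<close> and had no room left.\<close>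

lemma not_admissible_insertD:
  assumes I: "admissible I" "finite I" and p: "p \<notin> I" "\<not> admissible (insert p I)"
    and coarser: "\<And>q. q \<in> I \<Longrightarrow> snd q \<le> snd p"
  shows "(\<exists>q\<in>I. dist (fst p) (fst q) < M * dyad (snd q)) \<or>
    (\<exists>j. dist (fst p) (y j) < 2 * dyad (lev j) \<and> saturated I j)"
proof (rule ccontr)
  assume contr: "\<not> ?thesis"
  have far: "M * dyad (snd q) \<le> dist (fst p) (fst q)" if "q \<in> I" for q
    using contr that by (auto simp: not_less)
  have "M * dyad (snd p) \<le> M * dyad (snd q)" if "q \<in> I" for q
    using M_pos dyad_antimono[OF coarser[OF that]] by simp
  with far have far': "M * dyad (snd p) \<le> dist (fst p) (fst q)" if "q \<in> I" for q
    using that by (meson order_trans)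
  have "mass (insert p I \<inter> near j) \<le> L * dyad (lev j) ^ k" for j
  proof (cases "p \<in> near j")
    case False
    then have "insert p I \<inter> near j = I \<inter> near j" by blast
    then show ?thesis using I(1) unfolding admissible_def by simp
  next
    case True
    then have "lev j \<le> snd p" "\<not> saturated I j"
      using contr unfolding near_def by auto
    then have "mass (I \<inter> near j) \<le> (L - 1) * dyad (lev j) ^ k"
      using I(2) unfolding saturated_def by (meson finite_Int not_less order_refl)
    moreover have "mass (insert p I \<inter> near j) = dyad (snd p) ^ k + mass (I \<inter> near j)"
      using True I(2) p(1) by (simp add: mass_def)
    moreover have "dyad (snd p) ^ k \<le> dyad (lev j) ^ k"
      using \<open>lev j \<le> snd p\<close> by (intro power_mono dyad_antimono) auto
    ultimately show ?thesis by (simp add: algebra_simps)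
  qed
  then have "admissible (insert p I)"
    using I(1) far far' unfolding admissible_def by (auto simp: dist_commute)
  with p(2) show False by blast
qed

lemma saturated_mono: "saturated I j \<Longrightarrow> I \<subseteq> I' \<Longrightarrow> saturated I' j"
  unfolding saturated_def by blast

text \<open>Members of one level have equal mass, so the mass bound limits their number and an
  extension of greatest cardinality exists.\<close>

lemma maximal_level_extension:
  assumes I: "admissible I" "finite I"
    and bound: "\<And>X. X \<subseteq> G \<Longrightarrow> (\<forall>p\<in>X. snd p = n) \<Longrightarrow> finite X \<Longrightarrow> admissible (I \<union> X) \<Longrightarrow> mass (I \<union> X) < R"
  obtains X where "X \<subseteq> G" "\<forall>p\<in>X. snd p = n" "finite X" "admissible (I \<union> X)"
    "\<And>p. p \<in> G \<Longrightarrow> snd p = n \<Longrightarrow> p \<in> I \<union> X \<or> \<not> admissible (insert p (I \<union> X))"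
proof -
  let ?P = "\<lambda>X. X \<subseteq> G \<and> (\<forall>p\<in>X. snd p = n) \<and> finite X \<and> admissible (I \<union> X)"
  have "card X < Suc (nat \<lceil>R / dyad n ^ k\<rceil>)" if X: "?P X" for X
  proof -
    have "real (card X) * dyad n ^ k = mass X" using X by (simp add: mass_def)
    also have "\<dots> \<le> mass (I \<union> X)" using X I(2) by (intro mass_mono) auto
    also have "\<dots> < R" using X by (intro bound) auto
    finally have "real (card X) < R / dyad n ^ k" by (simp add: field_simps)
    then show ?thesis by linarith
  qed
  moreover have "?P {}" using I by simp
  ultimately obtain X where X: "?P X" "\<And>X'. ?P X' \<Longrightarrow> card X' \<le> card X"
    using ex_has_greatest_nat[of ?P "{}" card "Suc (nat \<lceil>R / dyad n ^ k\<rceil>)"] by blast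
  have "\<not> admissible (insert p (I \<union> X))" if p: "p \<in> G" "snd p = n" "p \<notin> I \<union> X" for p
  proof
    assume "admissible (insert p (I \<union> X))"
    then have "?P (insert p X)" using X(1) p by simp
    then have "card (insert p X) \<le> card X" by (rule X(2))
    then show False using p(3) X(1) by simp
  qed
  then show ?thesis using X(1) that by blast
qed

lemma greedy_packing:
  assumes bound: "\<And>I. finite I \<Longrightarrow> I \<subseteq> {p \<in> G. m \<le> snd p} \<Longrightarrow> admissible I \<Longrightarrow> mass I < R"
  obtains I where "I \<subseteq> {p \<in> G. m \<le> snd p}" "countable I"
    "\<And>J. finite J \<Longrightarrow> J \<subseteq> I \<Longrightarrow> mass J \<le> R"
    "\<And>p. p \<in> G \<Longrightarrow> m \<le> snd p \<Longrightarrow> (\<exists>q\<in>I. dist (fst p) (fst q) < M * dyad (snd q)) \<or>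
       (\<exists>j. dist (fst p) (y j) < 2 * dyad (lev j) \<and> saturated I j)"
proof -
  define P where "P t I \<longleftrightarrow> finite I \<and> admissible I \<and> I \<subseteq> {p \<in> G. m \<le> snd p \<and> snd p < m + t}" for t I
  define Q where "Q t I I' \<longleftrightarrow>
    I \<subseteq> I' \<and> (\<forall>p\<in>G. snd p = m + t \<longrightarrow> p \<in> I' \<or> \<not> admissible (insert p I'))" for t :: nat and I I'
  have "\<exists>I. \<forall>t. P t (I t) \<and> Q t (I t) (I (Suc t))"
  \<comment> \<open>Passing from stage \<open>t\<close> to stage \<open>Suc t\<close> exhausts level
    \<open>m + t\<close>.\<close>
  proof (rule dependent_nat_choice)
    show "\<exists>I. P 0 I" using admissible_empty unfolding P_def by (intro exI[of _ "{}"]) simp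
  next
    fix I t assume I: "P t I"
    have "mass (I \<union> X) < R" if "X \<subseteq> G" "\<forall>p\<in>X. snd p = m + t" "finite X" "admissible (I \<union> X)" for X
      using that I unfolding P_def by (intro bound) auto
    then obtain X where X: "X \<subseteq> G" "\<forall>p\<in>X. snd p = m + t" "finite X" "admissible (I \<union> X)"
      "\<And>p. p \<in> G \<Longrightarrow> snd p = m + t \<Longrightarrow> p \<in> I \<union> X \<or> \<not> admissible (insert p (I \<union> X))"
      using maximal_level_extension[of I G "m + t" R] I unfolding P_def by blast
    then show "\<exists>I'. P (Suc t) I' \<and> Q t I I'"
      using I unfolding P_def Q_def by (intro exI[of _ "I \<union> X"]) auto
  qed
  then obtain I where seq: "\<And>t. P t (I t)" "\<And>t. Q t (I t) (I (Suc t))" by blast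
  have I: "finite (I t)" "admissible (I t)" "I t \<subseteq> {p \<in> G. m \<le> snd p \<and> snd p < m + t}" for t
    using seq(1)[of t] unfolding P_def by auto
  have step: "I t \<subseteq> I (Suc t)"
    "\<And>p. p \<in> G \<Longrightarrow> snd p = m + t \<Longrightarrow> p \<in> I (Suc t) \<or> \<not> admissible (insert p (I (Suc t)))" for t
    using seq(2)[of t] unfolding Q_def by blast+
  have mono: "I t \<subseteq> I t'" if "t \<le> t'" for t t'
    using step(1) that by (rule lift_Suc_mono_le)
  show ?thesis
  proof (rule that[of "\<Union>t. I t"])
    show "(\<Union>t. I t) \<subseteq> {p \<in> G. m \<le> snd p}" using I(3) by blast
    show "countable (\<Union>t. I t)" using I(1) by (intro countable_UN) (auto intro: countable_finite)
  next
    fix J assume "finite J" "J \<subseteq> (\<Union>t. I t)"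
    then have "\<exists>t. J \<subseteq> I t"
    proof (induction J)
      case (insert p J)
      then obtain t t' where t: "J \<subseteq> I t" "p \<in> I t'" by auto
      then show ?case using mono[of t "max t t'"] mono[of t' "max t t'"] by (intro exI[of _ "max t t'"]) auto
    qed simp
    then obtain t where "J \<subseteq> I t" by blast
    then have "mass J \<le> mass (I t)" using I by (intro mass_mono) auto
    also have "\<dots> < R" using I by (intro bound) auto
    finally show "mass J \<le> R" by simp
  next
    fix p assume p: "p \<in> G" "m \<le> snd p"
    \<comment> \<open>The stage that has just treated the level of \<open>p\<close>: its members are
      all at least as coarse as \<open>p\<close>, as \<open>not_admissible_insertD\<close>
      requires.\<close>
    let ?I = "I (Suc (snd p - m))"
    show "(\<exists>q\<in>\<Union>t. I t. dist (fst p) (fst q) < M * dyad (snd q)) \<or>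
       (\<exists>j. dist (fst p) (y j) < 2 * dyad (lev j) \<and> saturated (\<Union>t. I t) j)"
    proof (cases "p \<in> ?I")
      case True
      then show ?thesis using M_pos by (intro disjI1 bexI[of _ p]) auto
    next
      case False
      have "\<not> admissible (insert p ?I)"
        using step(2)[of p "snd p - m"] p False by auto
      moreover have "snd q \<le> snd p" if "q \<in> ?I" for q
        using I(3)[of "Suc (snd p - m)"] that p by auto
      ultimately have "(\<exists>q\<in>?I. dist (fst p) (fst q) < M * dyad (snd q)) \<or>
        (\<exists>j. dist (fst p) (y j) < 2 * dyad (lev j) \<and> saturated ?I j)"
        using I False by (intro not_admissible_insertD) auto
      then show ?thesis
        using saturated_mono[of ?I _ "\<Union>t. I t"] by blast
    qed
  qed
qed

text \<open>Vitali's covering argument, in which disjointness of two balls is weakened to having no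
  member of \<open>I\<close> in common.\<close>

lemma saturated_Vitali:
  assumes bound: "\<And>J. finite J \<Longrightarrow> J \<subseteq> I \<Longrightarrow> mass J \<le> R"
  obtains S where "\<And>T. finite T \<Longrightarrow> T \<subseteq> S \<Longrightarrow> (L - 1) * (\<Sum>j\<in>T. dyad (lev j) ^ k) \<le> R"
    "\<And>j x. saturated I j \<Longrightarrow> dist x (y j) < 2 * dyad (lev j) \<Longrightarrow>
       \<exists>i\<in>S. dist x (y i) < 6 * dyad (lev i)"
proof -
  \<comment> \<open>Decreasing radius, with ties broken by the index, so that any two distinct
    indices are comparable.\<close>
  let ?r = "inv_image (less_than <*lex*> less_than) (\<lambda>j. (lev j, j))"
  have "wf ?r" by (intro wf_inv_image wf_lex_prod wf_less_than)
  then obtain S0 where S0: "\<And>j. j \<in> S0 \<longleftrightarrow>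
      (\<forall>i\<in>S0. (i, j) \<in> ?r \<longrightarrow> \<not> (saturated I i \<and> I \<inter> near i \<inter> near j \<noteq> {}))"
    using wf_greedy_set[of ?r "\<lambda>i j. saturated I i \<and> I \<inter> near i \<inter> near j \<noteq> {}"] by blast
  define S where "S = {j \<in> S0. saturated I j}"
  show ?thesis
  proof (rule that[of S])
    fix T assume T: "finite T" "T \<subseteq> S"
    then have "\<forall>j\<in>T. \<exists>J. finite J \<and> J \<subseteq> I \<inter> near j \<and> (L - 1) * dyad (lev j) ^ k < mass J"
      unfolding S_def saturated_def by blast
    then obtain J where J: "\<And>j. j \<in> T \<Longrightarrow> finite (J j)" "\<And>j. j \<in> T \<Longrightarrow> J j \<subseteq> I \<inter> near j"
      "\<And>j. j \<in> T \<Longrightarrow> (L - 1) * dyad (lev j) ^ k < mass (J j)"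
      by metis
    have empty: "I \<inter> near i \<inter> near j = {}"
      if "i \<in> S0" "j \<in> S0" "saturated I i" "(i, j) \<in> ?r" for i j
      using S0[of j] that by blast
    have disj: "J i \<inter> J j = {}" if "i \<in> T" "j \<in> T" "i \<noteq> j" for i j
    proof -
      have "(i, j) \<in> ?r \<or> (j, i) \<in> ?r" using that(3) by auto
      moreover have "i \<in> S0" "saturated I i" "j \<in> S0" "saturated I j"
        using that T(2) unfolding S_def by auto
      ultimately have "I \<inter> near i \<inter> near j = {} \<or> I \<inter> near j \<inter> near i = {}"
        using empty[of i j] empty[of j i] by blast
      then show ?thesis using J(2)[OF that(1)] J(2)[OF that(2)] by blast
    qed
    have "(L - 1) * (\<Sum>j\<in>T. dyad (lev j) ^ k) \<le> (\<Sum>j\<in>T. mass (J j))"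
      unfolding sum_distrib_left using J(3) by (intro sum_mono) (simp add: less_imp_le)
    also have "\<dots> = mass (\<Union>j\<in>T. J j)"
      unfolding mass_def using T(1) J(1) disj by (intro sum.UNION_disjoint[symmetric]) auto
    also have "\<dots> \<le> R" using T(1) J(1,2) by (intro bound) auto
    finally show "(L - 1) * (\<Sum>j\<in>T. dyad (lev j) ^ k) \<le> R" .
  next
    fix j x assume j: "saturated I j" "dist x (y j) < 2 * dyad (lev j)"
    show "\<exists>i\<in>S. dist x (y i) < 6 * dyad (lev i)"
    proof (cases "j \<in> S0")
      case True
      have "dist x (y j) < 6 * dyad (lev j)" using j(2) dyad_pos[of "lev j"] by linarith
      then show ?thesis using True j(1) unfolding S_def by blast
    next
      case False
      then obtain i p where i: "i \<in> S0" "(i, j) \<in> ?r" "saturated I i" "p \<in> near i" "p \<in> near j"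
        using S0[of j] by blast
      \<comment> \<open>The shared member \<open>p\<close> links ball \<open>j\<close> to the
        earlier ball \<open>i\<close>, which is at least as large: 2 + 2 + 2 radii give the factor
        6.\<close>
      have "dist x (y i) \<le> dist x (y j) + dist (fst p) (y j) + dist (fst p) (y i)"
        using dist_triangle[of x "y i" "y j"] dist_triangle[of "y j" "y i" "fst p"]
        by (simp add: dist_commute)
      also have "\<dots> < 2 * dyad (lev j) + 2 * dyad (lev j) + 2 * dyad (lev i)"
        using j(2) i(4,5) unfolding near_def by auto
      also have "dyad (lev j) \<le> dyad (lev i)" using i(2) by (intro dyad_antimono) auto
      finally have "dist x (y i) < 6 * dyad (lev i)" by simp
      then show ?thesis using i unfolding S_def by blast
    qed
  qed
qed

end

section \<open>Weights of balls and the content estimate\<close>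

lemma hausdorff_weight_ball_le:
  assumes "0 \<le> r" shows "hausdorff_weight k (ball x r) \<le> ennreal ((2 * r) ^ k)"
proof (rule hausdorff_weight_le)
  fix u v assume "u \<in> ball x r" "v \<in> ball x r"
  then show "dist u v \<le> 2 * r" using dist_triangle[of u v x] by (simp add: dist_commute)
qed (use assms in simp)

lemma ediameter_ball_le: "ediameter (ball x r) \<le> ennreal (2 * r)"
proof (rule ediameter_le)
  fix u v assume "u \<in> ball x r" "v \<in> ball x r"
  then show "dist u v \<le> 2 * r" using dist_triangle[of u v x] by (simp add: dist_commute)
qed

lemma sum_hausdorff_weight_ball_le:
  assumes "finite T" "0 \<le> c"
  shows "(\<Sum>q\<in>T. hausdorff_weight k (ball (z q) (c * dyad (lv q)))) \<le>
    ennreal ((2 * c) ^ k * (\<Sum>q\<in>T. dyad (lv q) ^ k))"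
proof -
  have "(\<Sum>q\<in>T. hausdorff_weight k (ball (z q) (c * dyad (lv q)))) \<le>
      (\<Sum>q\<in>T. ennreal ((2 * c) ^ k * dyad (lv q) ^ k))"
    using assms(2) by (intro sum_mono order_trans[OF hausdorff_weight_ball_le])
      (auto simp: power_mult_distrib mult_ac)
  also have "\<dots> = ennreal ((2 * c) ^ k * (\<Sum>q\<in>T. dyad (lv q) ^ k))"
    using assms(2) by (subst sum_ennreal) (auto simp: sum_distrib_left)
  finally show ?thesis .
qed

context multiscale_packing begin

text \<open>If the packing built from scale \<open>m0 + t\<close> on stays light for every \<open>t\<close>, its saturated balls cover
  what its own balls, enlarged by \<open>M\<close>, do not. Along a subsequence of \<open>t\<close> the sets of saturated balls
  converge. Outside the limit balls only arbitrarily small balls are used, with a bounded sum of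
  weights, so that the rest has finite measure.\<close>

lemma sigma_content_le_if_no_packing:
  fixes Gd :: "'a set"
  assumes fin: "\<And>m. finite {j. lev j \<le> m}" and R: "0 \<le> R"
    and bound: "\<And>I. finite I \<Longrightarrow> I \<subseteq> {p \<in> G. m0 \<le> snd p} \<Longrightarrow> admissible I \<Longrightarrow> mass I < R"
    and good: "\<And>x m. x \<in> Gd \<Longrightarrow> \<exists>n\<ge>m. (x, n) \<in> G"
  shows "sigma_content k Gd \<le> ennreal (12 ^ k * (R / (L - 1)))"
proof -
  have L: "0 < L - 1" using L_gt_1 by simp
  define C where "C t I S \<longleftrightarrow> I \<subseteq> {p \<in> G. m0 + t \<le> snd p} \<and> countable I \<and>
    (\<forall>J. finite J \<longrightarrow> J \<subseteq> I \<longrightarrow> mass J \<le> R) \<and>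
    (\<forall>T. finite T \<longrightarrow> T \<subseteq> S \<longrightarrow> (\<Sum>j\<in>T. dyad (lev j) ^ k) \<le> R / (L - 1)) \<and>
    (\<forall>x\<in>Gd. (\<exists>q\<in>I. x \<in> ball (fst q) (M * dyad (snd q))) \<or> (\<exists>i\<in>S. x \<in> ball (y i) (6 * dyad (lev i))))"
    for t I S
  have "\<exists>I S. C t I S" for t
  proof -
    have "mass I < R" if "finite I" "I \<subseteq> {p \<in> G. m0 + t \<le> snd p}" "admissible I" for I
      using that by (intro bound) auto
    then obtain I where I: "I \<subseteq> {p \<in> G. m0 + t \<le> snd p}" "countable I"
      "\<And>J. finite J \<Longrightarrow> J \<subseteq> I \<Longrightarrow> mass J \<le> R"
      "\<And>p. p \<in> G \<Longrightarrow> m0 + t \<le> snd p \<Longrightarrow> (\<exists>q\<in>I. dist (fst p) (fst q) < M * dyad (snd q)) \<or>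
         (\<exists>j. dist (fst p) (y j) < 2 * dyad (lev j) \<and> saturated I j)"
      using greedy_packing[of G "m0 + t" R] by blast
    obtain S where S: "\<And>T. finite T \<Longrightarrow> T \<subseteq> S \<Longrightarrow> (L - 1) * (\<Sum>j\<in>T. dyad (lev j) ^ k) \<le> R"
      "\<And>j x. saturated I j \<Longrightarrow> dist x (y j) < 2 * dyad (lev j) \<Longrightarrow>
         \<exists>i\<in>S. dist x (y i) < 6 * dyad (lev i)"
      using saturated_Vitali[of I R] I(3) by blast
    have "(\<exists>q\<in>I. x \<in> ball (fst q) (M * dyad (snd q))) \<or> (\<exists>i\<in>S. x \<in> ball (y i) (6 * dyad (lev i)))"
      if x: "x \<in> Gd" for x
    proof -
      obtain n where "m0 + t \<le> n" "(x, n) \<in> G" using good[OF x] by blast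
      then show ?thesis
        using I(4)[of "(x, n)"] S(2)[of _ x] by (auto simp: mem_ball dist_commute)
    qed
    moreover have "(\<Sum>j\<in>T. dyad (lev j) ^ k) \<le> R / (L - 1)" if "finite T" "T \<subseteq> S" for T
      using S(1)[OF that] L by (simp add: field_simps)
    ultimately show ?thesis using I unfolding C_def by (intro exI[of _ I] exI[of _ S]) blast
  qed
  then obtain I S where C: "\<And>t. C t (I t) (S t)" by metis
  have I: "I t \<subseteq> {p \<in> G. m0 + t \<le> snd p}" "countable (I t)"
    "\<And>J. finite J \<Longrightarrow> J \<subseteq> I t \<Longrightarrow> mass J \<le> R"
    and S: "\<And>T. finite T \<Longrightarrow> T \<subseteq> S t \<Longrightarrow> (\<Sum>j\<in>T. dyad (lev j) ^ k) \<le> R / (L - 1)"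
    and cov: "\<And>x. x \<in> Gd \<Longrightarrow> (\<exists>q\<in>I t. x \<in> ball (fst q) (M * dyad (snd q))) \<or>
      (\<exists>i\<in>S t. x \<in> ball (y i) (6 * dyad (lev i)))" for t
    using C[of t] unfolding C_def by blast+
  obtain r J where r: "strict_mono (r :: nat \<Rightarrow> nat)"
    and J: "\<And>i. \<forall>\<^sub>F n in sequentially. i \<in> S (r n) \<longleftrightarrow> i \<in> J"
    using convergent_subsequence_of_sets[of S] by blast
  \<comment> \<open>Any finite part of the limit \<open>J\<close> lies in one of the families
    \<open>S (r n)\<close> and inherits its bound.\<close>
  have J_sum: "(\<Sum>j\<in>T. dyad (lev j) ^ k) \<le> R / (L - 1)" if T: "finite T" "T \<subseteq> J" for T
  proof -
    have "\<forall>\<^sub>F n in sequentially. \<forall>i\<in>T. i \<in> S (r n) \<longleftrightarrow> i \<in> J"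
      using T(1) J by (intro eventually_ball_finite) auto
    then obtain n where "\<forall>i\<in>T. i \<in> S (r n) \<longleftrightarrow> i \<in> J"
      using eventually_happens[of _ sequentially] by auto
    then show ?thesis using T by (intro S[of T "r n"]) auto
  qed
  let ?B = "\<lambda>i. ball (y i) (6 * dyad (lev i))"
  let ?W = "Gd - (\<Union>i\<in>J. ?B i)"
  have "hausdorff_premeasure k \<delta> ?W \<le> ennreal ((2 * M) ^ k * R + 12 ^ k * (R / (L - 1)))"
    if \<delta>: "0 < \<delta>" for \<delta>
  proof -
    obtain m where m: "12 * dyad m \<le> \<delta>"
      using eventually_happens[OF eventually_dyad_le[OF \<delta>, of 12]] by auto
    \<comment> \<open>Only finitely many net points have level at most \<open>m\<close>, so for
      large \<open>n\<close> the coarse members of \<open>S (r n)\<close> are exactly those of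
      \<open>J\<close>. A point outside the balls of \<open>J\<close> is therefore covered by a ball
      of diameter at most \<open>\<delta>\<close>.\<close>
    have "\<forall>\<^sub>F n in sequentially. \<forall>i\<in>{j. lev j \<le> m}. i \<in> S (r n) \<longleftrightarrow> i \<in> J"
      using fin J by (intro eventually_ball_finite) auto
    from eventually_conj[OF this eventually_dyad_le[OF \<delta>, of "2 * M"]]
    obtain n where n: "\<And>i. lev i \<le> m \<Longrightarrow> i \<in> S (r n) \<longleftrightarrow> i \<in> J" "2 * M * dyad n \<le> \<delta>"
      using eventually_happens[of _ sequentially] by auto
    define S' where "S' = {i \<in> S (r n). m < lev i}"
    let ?Q = "I (r n) <+> S'"
    let ?f = "case_sum (\<lambda>q. ball (fst q) (M * dyad (snd q))) ?B"
    show ?thesis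
    proof (rule hausdorff_premeasure_le_family[of ?Q _ ?f])
      show "countable ?Q" using I(2) by (intro countable_Plus) auto
    next
      show "?W \<subseteq> (\<Union>q\<in>?Q. ?f q)"
      proof
        fix x assume x: "x \<in> ?W"
        show "x \<in> (\<Union>q\<in>?Q. ?f q)"
        proof (cases "\<exists>q\<in>I (r n). x \<in> ball (fst q) (M * dyad (snd q))")
          case True
          then obtain q where "q \<in> I (r n)" "x \<in> ball (fst q) (M * dyad (snd q))" by blast
          then show ?thesis by (intro UN_I[of "Inl q"]) auto
        next
          case False
          then obtain i where i: "i \<in> S (r n)" "x \<in> ?B i" using cov[of x "r n"] x by blast
          then have "i \<notin> J" using x by blast
          then have "i \<in> S'" using n(1)[of i] i(1) unfolding S'_def by (auto simp: not_le[symmetric])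
          then show ?thesis using i(2) by (intro UN_I[of "Inr i"]) auto
        qed
      qed
    next
      fix q assume q: "q \<in> ?Q"
      show "ediameter (?f q) \<le> ennreal \<delta>"
      proof (cases q)
        case (Inl p)
        then have "n \<le> snd p" using q I(1)[of "r n"] seq_suble[OF r, of n] by auto
        then have "2 * M * dyad (snd p) \<le> 2 * M * dyad n"
          using M_pos by (intro mult_left_mono dyad_antimono) auto
        then show ?thesis
          using Inl n(2) by (auto intro!: order_trans[OF ediameter_ball_le] ennreal_leI)
      next
        case (Inr i)
        then have "dyad (lev i) \<le> dyad m"
          using q unfolding S'_def by (intro dyad_antimono) auto
        then show ?thesis
          using Inr m by (auto intro!: order_trans[OF ediameter_ball_le] ennreal_leI)
      qed
    next
      fix Q' assume Q': "finite Q'" "Q' \<subseteq> ?Q"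
      let ?A = "Inl -` Q'" and ?C = "Inr -` Q'"
      have eq: "Q' = ?A <+> ?C"
        using Q'(2) by (auto simp: Plus_def image_iff)
      have fin': "finite ?A" "finite ?C" using Q'(1) by (auto intro: finite_vimageI)
      have A: "mass ?A \<le> R" using Q'(2) fin' by (intro I(3)[of _ "r n"]) auto
      have C: "(\<Sum>j\<in>?C. dyad (lev j) ^ k) \<le> R / (L - 1)"
        using Q'(2) fin' unfolding S'_def by (intro S[of _ "r n"]) auto
      have "(\<Sum>q\<in>Q'. hausdorff_weight k (?f q)) =
          (\<Sum>q\<in>?A. hausdorff_weight k (ball (fst q) (M * dyad (snd q)))) +
          (\<Sum>i\<in>?C. hausdorff_weight k (?B i))"
        by (subst eq) (simp add: sum.Plus fin' o_def)
      also have "\<dots> \<le> ennreal ((2 * M) ^ k * mass ?A) + ennreal ((2 * 6) ^ k * (\<Sum>j\<in>?C. dyad (lev j) ^ k))"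
        unfolding mass_def using fin' M_pos by (intro add_mono sum_hausdorff_weight_ball_le) auto
      also have "\<dots> \<le> ennreal ((2 * M) ^ k * R) + ennreal (12 ^ k * (R / (L - 1)))"
        using A C M_pos
        by (intro add_mono ennreal_leI mult_mono) (auto simp: sum_nonneg mass_def)
      also have "\<dots> = ennreal ((2 * M) ^ k * R + 12 ^ k * (R / (L - 1)))"
        using R L M_pos by (intro ennreal_plus[symmetric]) auto
      finally show "(\<Sum>q\<in>Q'. hausdorff_weight k (?f q)) \<le>
        ennreal ((2 * M) ^ k * R + 12 ^ k * (R / (L - 1)))" .
    qed
  qed
  \<comment> \<open>The bound is independent of \<open>\<delta>\<close>. It grows with
    \<open>M\<close>, but finiteness is enough, since the content discards
    \<open>?W\<close>.\<close>
  then have "hausdorff_measure k ?W \<le> ennreal ((2 * M) ^ k * R + 12 ^ k * (R / (L - 1)))"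
    by (rule hausdorff_measure_le)
  then have "hausdorff_sigma_finite k ?W"
    by (intro hausdorff_sigma_finite_if_finite) (auto intro: le_less_trans)
  then show ?thesis
  proof (rule sigma_content_le_family[rotated])
    fix Q' assume Q': "finite Q'" "Q' \<subseteq> J"
    have "(\<Sum>i\<in>Q'. hausdorff_weight k (?B i)) \<le> ennreal ((2 * 6) ^ k * (\<Sum>j\<in>Q'. dyad (lev j) ^ k))"
      by (intro sum_hausdorff_weight_ball_le Q') simp
    also have "\<dots> \<le> ennreal (12 ^ k * (R / (L - 1)))"
      using J_sum[OF Q'] by (intro ennreal_leI mult_mono) (auto simp: sum_nonneg)
    finally show "(\<Sum>i\<in>Q'. hausdorff_weight k (?B i)) \<le> ennreal (12 ^ k * (R / (L - 1)))" .
  qed simp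
qed

end

text \<open>By contraposition of \<open>sigma_content_le_if_no_packing\<close> a large content
  forces a packing of mass at least \<open>dyad N ^ k\<close>, which is then trimmed to equality.
  The pieces \<open>A' i\<close> are meant for the next entry of the Souslin index.\<close>

lemma packing_step:
  fixes A :: "'a::metric_space set" and A' :: "nat \<Rightarrow> 'a set"
  assumes K: "compact K" "A \<subseteq> K" and A': "A = (\<Union>i. A' i)" and k: "0 < k" and M: "0 < M"
    and A: "ennreal (dyad N ^ k / 2 ^ Suc k) \<le> sigma_content k A"
  obtains I :: "('a \<times> nat) set"
  where "finite I" "(\<Sum>p\<in>I. dyad (snd p) ^ k) = dyad N ^ k"
    "\<And>p. p \<in> I \<Longrightarrow> fst p \<in> A \<and> N < snd p \<and>
       (\<exists>i. ennreal (dyad (snd p) ^ k / 2 ^ Suc k) \<le> sigma_content k (A' i \<inter> cball (fst p) (dyad (snd p))))"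
    "\<And>p q. p \<in> I \<Longrightarrow> q \<in> I \<Longrightarrow> p \<noteq> q \<Longrightarrow> M * dyad (snd p) \<le> dist (fst p) (fst q)"
    "\<And>m z. z \<in> K \<Longrightarrow> (\<Sum>p | p \<in> I \<and> m \<le> snd p \<and> dist (fst p) z < dyad m. dyad (snd p) ^ k)
       \<le> (12 ^ k * 2 ^ Suc k + 2) * dyad m ^ k"
proof -
  let ?low = "\<lambda>n. ennreal (dyad n ^ k / 2 ^ Suc k)"
  \<comment> \<open>\<open>?L - 1\<close> exceeds \<open>12 ^ k * 2 ^ Suc k\<close>, which makes the
    comparison with \<open>?low N\<close> below strict.\<close>
  let ?L = "12 ^ k * 2 ^ Suc k + 2 :: real"
  have "sigma_content k A > 0" by (rule less_le_trans[OF _ A]) simp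
  then have "A \<noteq> {}" using sigma_content_le_weight[of k A] by auto
  then have "K \<noteq> {}" using K(2) by blast
  obtain y :: "nat \<Rightarrow> 'a" and lev where fin: "\<And>m. finite {j. lev j \<le> m}"
    and net: "\<And>m x. x \<in> K \<Longrightarrow> \<exists>j. lev j = m \<and> dist x (y j) < dyad m"
    using compact_multiscale_net[OF K(1) \<open>K \<noteq> {}\<close>] by metis
  interpret multiscale_packing k M ?L y lev
    using M by unfold_locales (auto intro: add_nonneg_pos)
  \<comment> \<open>Goodness is measured inside one piece. Up to a sigma-finite set, every point of
    a piece is good for that piece, so no piece has to carry a definite share of the content of
    \<open>A\<close>.\<close>
  define G where "G = {p. fst p \<in> A \<and>
    (\<exists>i. ?low (snd p) \<le> sigma_content k (A' i \<inter> cball (fst p) (dyad (snd p))))}"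
  define Gd where "Gd = {x. \<forall>m. \<exists>n\<ge>m. (x, n) \<in> G}"
  have "hausdorff_sigma_finite k (A - Gd)"
  proof -
    let ?Z = "\<lambda>i. {x \<in> A' i. \<not> (\<forall>m. \<exists>n\<ge>m. ?low n \<le> sigma_content k (A' i \<inter> cball x (dyad n)))}"
    have "A - Gd \<subseteq> (\<Union>i. ?Z i)"
    proof
      fix x assume x: "x \<in> A - Gd"
      then obtain i where i: "x \<in> A' i" using A' by blast
      obtain m where "\<And>n. m \<le> n \<Longrightarrow> (x, n) \<notin> G" using x unfolding Gd_def by blast
      then have "x \<in> ?Z i" using i x unfolding G_def by fastforce
      then show "x \<in> (\<Union>i. ?Z i)" by blast
    qed
    moreover have "hausdorff_sigma_finite k (?Z i)" for i
      using K A' k by (intro sigma_finite_low_density[of K]) auto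
    ultimately show ?thesis by (rule hausdorff_sigma_finite_subset_UN)
  qed
  then have "sigma_content k (Gd \<union> (A - Gd)) \<le> sigma_content k Gd"
    by (rule sigma_content_Un_null)
  then have A_Gd: "?low N \<le> sigma_content k Gd"
    using A sigma_content_mono[of A "Gd \<union> (A - Gd)" k] by (auto intro: order_trans)
  have "\<exists>I. finite I \<and> I \<subseteq> {p \<in> G. Suc N \<le> snd p} \<and> admissible I \<and> dyad N ^ k \<le> mass I"
  proof (rule ccontr)
    assume "\<not> ?thesis"
    then have "mass I < dyad N ^ k"
      if "finite I" "I \<subseteq> {p \<in> G. Suc N \<le> snd p}" "admissible I" for I
      using that by (meson not_le)
    then have "sigma_content k Gd \<le> ennreal (12 ^ k * (dyad N ^ k / (?L - 1)))"
      by (rule sigma_content_le_if_no_packing[OF fin, rotated]) (auto simp: Gd_def)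
    with A_Gd have "?low N \<le> ennreal (12 ^ k * (dyad N ^ k / (?L - 1)))" by (rule order_trans)
    moreover have "0 \<le> 12 ^ k * (dyad N ^ k / (?L - 1))" by simp
    ultimately have "dyad N ^ k / 2 ^ Suc k \<le> 12 ^ k * (dyad N ^ k / (?L - 1))"
      by (simp add: ennreal_le_iff)
    moreover have "q * (a / (q * c + 2 - 1)) < a / c" if "0 < a" "0 < c" "0 < q" for a c q :: real
    proof -
      have "a * q * c < a * (q * c + 1)" using that by (simp add: distrib_left mult.assoc)
      moreover have "0 < q * c + 1" using that by (simp add: add_pos_pos)
      ultimately show ?thesis using that by (simp add: pos_divide_less_eq pos_less_divide_eq mult_ac)
    qed
    ultimately show False
      by (meson dyad_pos not_le zero_less_numeral zero_less_power)
  qed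
  then obtain I where I: "finite I" "I \<subseteq> {p \<in> G. Suc N \<le> snd p}" "admissible I" "dyad N ^ k \<le> mass I"
    by blast
  have "N \<le> snd p" if "p \<in> I" for p using I(2) that by auto
  with I(1,4) obtain J where J: "J \<subseteq> I" "(\<Sum>p\<in>J. dyad (snd p) ^ k) = dyad N ^ k"
    using exact_dyadic_subsum[of I N snd k] unfolding mass_def by blast
  have adm: "admissible J" using I(3,1) J(1) by (rule admissible_subset)
  show ?thesis
  proof (rule that[of J])
    show fJ: "finite J" using J(1) I(1) by (rule finite_subset)
    show "fst p \<in> A \<and> N < snd p \<and>
       (\<exists>i. ?low (snd p) \<le> sigma_content k (A' i \<inter> cball (fst p) (dyad (snd p))))" if "p \<in> J" for p
      using that J(1) I(2) unfolding G_def by auto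
    show "M * dyad (snd p) \<le> dist (fst p) (fst q)" if "p \<in> J" "q \<in> J" "p \<noteq> q" for p q
      using adm that unfolding admissible_def by blast
    fix m z assume "z \<in> K"
    then obtain j where j: "lev j = m" "dist z (y j) < dyad m" using net by blast
    have "dist (fst p) (y j) < 2 * dyad m" if "dist (fst p) z < dyad m" for p :: "'a \<times> nat"
      using that j(2) dist_triangle[of "fst p" "y j" z] by simp
    then have "{p. p \<in> J \<and> m \<le> snd p \<and> dist (fst p) z < dyad m} \<subseteq> J \<inter> near j"
      unfolding near_def using j(1) by auto
    then have "mass {p. p \<in> J \<and> m \<le> snd p \<and> dist (fst p) z < dyad m} \<le> mass (J \<inter> near j)"
      using fJ by (intro mass_mono) auto
    also have "\<dots> \<le> ?L * dyad m ^ k" using adm j(1) unfolding admissible_def by blast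
    finally show "(\<Sum>p | p \<in> J \<and> m \<le> snd p \<and> dist (fst p) z < dyad m. dyad (snd p) ^ k)
       \<le> ?L * dyad m ^ k" unfolding mass_def .
  qed (use J in simp)
qed

section \<open>Cantor sets from trees of separated nodes\<close>

text \<open>\<open>pre\<close> is the initial segment of the Souslin index fixed so far.
  \<open>body\<close> is the piece whose content is known; it need not be closed, and closures are
  taken only when the layers are formed.\<close>

datatype 'a node = Node (pre: "nat list") (body: "'a set") (ctr: 'a) (lvl: nat)

lemma sum_UN_le_sum_sum:
  fixes f :: "'b \<Rightarrow> real"
  assumes "finite I" "\<And>i. i \<in> I \<Longrightarrow> finite (A i)" "\<And>x. 0 \<le> f x"
  shows "sum f (\<Union>i\<in>I. A i) \<le> (\<Sum>i\<in>I. sum f (A i))"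
  using assms(1,2)
proof (induction I)
  case (insert i I)
  have "sum f (A i \<union> (\<Union>i\<in>I. A i)) \<le> sum f (A i) + sum f (\<Union>i\<in>I. A i)"
    using insert assms(3) by (subst sum_Un) (auto intro!: sum_nonneg)
  then show ?case using insert by force
qed simp

text \<open>Prepares the passage to a finite subcover. Weight below 1 keeps the diameter below
  \<open>dyad 0\<close>, so that it can be rounded up to a dyadic scale even after fattening.
  Rounding costs the factor \<open>2 ^ k\<close>, fattening the summand
  \<open>\<eta>\<close>.\<close>

lemma open_enlargement:
  fixes V :: "'a::metric_space set"
  assumes k: "0 < k" and V: "hausdorff_weight k V < 1" and \<eta>: "0 < \<eta>"
  obtains m W where "open W" "V \<subseteq> W" "\<And>u v. u \<in> W \<Longrightarrow> v \<in> W \<Longrightarrow> dist u v \<le> dyad m"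
    "dyad m ^ k \<le> 2 ^ k * enn2real (hausdorff_weight k V) + \<eta>"
proof (cases "V = {}")
  case True
  have "(\<lambda>m. dyad m ^ k) \<longlonglongrightarrow> 0 ^ k" by (intro tendsto_power dyad_tendsto_0)
  then have "\<forall>\<^sub>F m in sequentially. dyad m ^ k < \<eta>"
    using \<eta> k by (intro order_tendstoD(2)) (auto simp: zero_power)
  then obtain m where "dyad m ^ k < \<eta>" using eventually_happens[of _ sequentially] by auto
  then show ?thesis using that[of "{}" m] True by simp
next
  case False
  then have w: "hausdorff_weight k V = ediameter V ^ k" by (simp add: hausdorff_weight_def)
  have "ediameter V < 1"
  proof (rule ccontr)
    assume "\<not> ?thesis"
    then have "1 ^ k \<le> ediameter V ^ k" by (intro power_mono) (auto simp: not_less)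
    then show False using V w by simp
  qed
  moreover obtain D where D: "ediameter V = ennreal D" "0 \<le> D"
    using calculation by (cases "ediameter V") (auto simp: top_unique)
  ultimately have "ennreal D < ennreal 1" by simp
  with D have D: "ediameter V = ennreal D" "0 \<le> D" "D < 1"
    by (simp_all add: ennreal_less_iff del: ennreal_1)
  have wD: "enn2real (hausdorff_weight k V) = D ^ k"
    unfolding w D(1) using D(2) by (simp add: ennreal_power)
  have dD: "dist u v \<le> D" if "u \<in> V" "v \<in> V" for u v
    using dist_le_ediameter[OF that] D by simp
  have "((\<lambda>h. (2 * (D + h)) ^ k) \<longlongrightarrow> (2 * (D + 0)) ^ k) (at_right 0)"
    by (intro tendsto_intros)
  then have "\<forall>\<^sub>F h in at_right 0. (2 * (D + h)) ^ k < (2 * D) ^ k + \<eta>"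
    using \<eta> by (intro order_tendstoD(2)) auto
  moreover have "\<forall>\<^sub>F h in at_right 0. h \<in> {0<..<1 - D}"
    using D(3) by (intro eventually_at_right_real) simp
  ultimately have "\<forall>\<^sub>F h in at_right 0. (2 * (D + h)) ^ k < (2 * D) ^ k + \<eta> \<and> h \<in> {0<..<1 - D}"
    by (rule eventually_conj)
  from eventually_happens[OF this]
  obtain h where h: "(2 * (D + h)) ^ k < (2 * D) ^ k + \<eta>" "0 < h" "h < 1 - D"
    by (auto simp: trivial_limit_at_right_real)
  obtain m where m: "D + h \<le> dyad m" "dyad m < 2 * (D + h)"
    using dyad_bracket[of "D + h" 0] h D by (auto simp: dyad_def)
  let ?W = "\<Union>v\<in>V. ball v (h / 2)"
  show ?thesis
  proof (rule that[of ?W m])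
    show "V \<subseteq> ?W" using h(2) by (auto intro!: centre_in_ball[THEN iffD2])
    fix u v assume "u \<in> ?W" "v \<in> ?W"
    then obtain u' v' where u': "u' \<in> V" "dist u' u < h / 2" and v': "v' \<in> V" "dist v' v < h / 2"
      by auto
    have "dist u v \<le> dist u' u + dist u' v' + dist v' v"
      using dist_triangle[of u v u'] dist_triangle[of u' v v'] by (simp add: dist_commute)
    also have "\<dots> \<le> dyad m" using u' v' dD[of u' v'] m(1) by simp
    finally show "dist u v \<le> dyad m" .
  next
    have "dyad m ^ k \<le> (2 * (D + h)) ^ k" using m(2) by (intro power_mono) auto
    then show "dyad m ^ k \<le> 2 ^ k * enn2real (hausdorff_weight k V) + \<eta>"
      using h(1) unfolding wD by (simp add: power_mult_distrib)
  qed auto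
qed

text \<open>In \<open>ch_separated\<close> the summand 2 absorbs the radii when centres are replaced
  by points of the bodies, and the power of 2 is the relative separation that grows with depth.
  \<open>ch_mass\<close> is an equality because the lower bound for the measure tolerates no loss of
  mass and the upper bound no gain.\<close>

locale cantor_tree =
  fixes k :: nat and L :: real and K :: "'a::metric_space set"
    and T :: "'a node set" and root :: "'a node" and ch :: "'a node \<Rightarrow> 'a node set"
  assumes k_pos: "0 < k" and L_ge_1: "1 \<le> L" and K: "compact K"
    and root: "root \<in> T" "pre root = []"
    and body_nonempty: "\<And>q. q \<in> T \<Longrightarrow> body q \<noteq> {}"
    and body_K: "\<And>q. q \<in> T \<Longrightarrow> body q \<subseteq> K"
    and body_cball: "\<And>q. q \<in> T \<Longrightarrow> body q \<subseteq> cball (ctr q) (dyad (lvl q))"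
    and ctr_K: "\<And>q. q \<in> T \<Longrightarrow> ctr q \<in> K"
    and finite_ch: "\<And>q. q \<in> T \<Longrightarrow> finite (ch q)"
    and ch_T: "\<And>q p. q \<in> T \<Longrightarrow> p \<in> ch q \<Longrightarrow> p \<in> T"
    and ch_body: "\<And>q p. q \<in> T \<Longrightarrow> p \<in> ch q \<Longrightarrow> body p \<subseteq> body q"
    and ch_lvl: "\<And>q p. q \<in> T \<Longrightarrow> p \<in> ch q \<Longrightarrow> lvl q < lvl p"
    and ch_pre: "\<And>q p. q \<in> T \<Longrightarrow> p \<in> ch q \<Longrightarrow> \<exists>i. pre p = pre q @ [i]"
    and ch_mass: "\<And>q. q \<in> T \<Longrightarrow> (\<Sum>p\<in>ch q. dyad (lvl p) ^ k) = dyad (lvl q) ^ k"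
    and ch_separated: "\<And>q p p'. q \<in> T \<Longrightarrow> p \<in> ch q \<Longrightarrow> p' \<in> ch q \<Longrightarrow> p \<noteq> p' \<Longrightarrow>
      (2 ^ Suc (length (pre q)) + 2) * dyad (lvl p) \<le> dist (ctr p) (ctr p')"
    and ch_spread: "\<And>q z m. q \<in> T \<Longrightarrow> z \<in> K \<Longrightarrow>
      (\<Sum>p | p \<in> ch q \<and> m \<le> lvl p \<and> dist (ctr p) z < dyad m. dyad (lvl p) ^ k) \<le> L * dyad m ^ k"
begin

primrec desc :: "nat \<Rightarrow> 'a node \<Rightarrow> 'a node set" where
  "desc 0 q = {q}"
| "desc (Suc j) q = (\<Union>p\<in>ch q. desc j p)"

text \<open>The mass that the natural measure on the tree would give to \<open>U\<close> at
  resolution \<open>j\<close>, as a finite sum, so that no measure is constructed. Recursion over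
  children counts each branch on its own, whether or not sets of descendants are disjoint.\<close>

primrec meeting_mass :: "nat \<Rightarrow> 'a node \<Rightarrow> 'a set \<Rightarrow> real" where
  "meeting_mass 0 q U = (if body q \<inter> U = {} then 0 else dyad (lvl q) ^ k)"
| "meeting_mass (Suc j) q U = (\<Sum>p\<in>ch q. meeting_mass j p U)"

definition layer :: "nat \<Rightarrow> 'a node \<Rightarrow> 'a set" where
  "layer j q = (\<Union>p\<in>desc j q. closure (body p))"

definition cantor_set :: "'a set" where
  "cantor_set = (\<Inter>j. layer j root)"

section \<open>Mass and separation in the tree\<close>

lemma desc_T: "q \<in> T \<Longrightarrow> p \<in> desc j q \<Longrightarrow> p \<in> T"
proof (induction j arbitrary: q)
  case (Suc j)
  then obtain q' where "q' \<in> ch q" "p \<in> desc j q'" by auto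
  then show ?case using Suc.IH Suc.prems(1) ch_T by blast
qed simp

lemma finite_desc: "q \<in> T \<Longrightarrow> finite (desc j q)"
proof (induction j arbitrary: q)
  case (Suc j)
  then show ?case using finite_ch[OF Suc.prems] ch_T[OF Suc.prems] by simp
qed simp

lemma desc_body: "q \<in> T \<Longrightarrow> p \<in> desc j q \<Longrightarrow> body p \<subseteq> body q"
proof (induction j arbitrary: q)
  case (Suc j)
  then obtain q' where "q' \<in> ch q" "p \<in> desc j q'" by auto
  then show ?case using Suc.IH[of q'] Suc.prems(1) ch_T ch_body by blast
qed simp

lemma desc_lvl: "q \<in> T \<Longrightarrow> p \<in> desc j q \<Longrightarrow> lvl q + j \<le> lvl p"
proof (induction j arbitrary: q)
  case (Suc j)
  then obtain q' where q': "q' \<in> ch q" "p \<in> desc j q'" by auto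
  then have "lvl q' + j \<le> lvl p" using Suc.IH[of q'] Suc.prems(1) ch_T by blast
  then show ?case using ch_lvl[OF Suc.prems(1) q'(1)] by simp
qed simp

lemma closure_body_cball: "q \<in> T \<Longrightarrow> closure (body q) \<subseteq> cball (ctr q) (dyad (lvl q))"
  using body_cball by (intro closure_minimal) auto

text \<open>An inequality suffices for the upper bound of the measure, and it avoids showing that
  different branches never share a node.\<close>

lemma sum_desc_le: "q \<in> T \<Longrightarrow> (\<Sum>p\<in>desc j q. dyad (lvl p) ^ k) \<le> dyad (lvl q) ^ k"
proof (induction j arbitrary: q)
  case (Suc j)
  have "(\<Sum>p\<in>desc (Suc j) q. dyad (lvl p) ^ k) \<le> (\<Sum>q'\<in>ch q. \<Sum>p\<in>desc j q'. dyad (lvl p) ^ k)"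
    using finite_ch[OF Suc.prems] finite_desc[OF ch_T[OF Suc.prems]]
    unfolding desc.simps by (intro sum_UN_le_sum_sum) auto
  also have "\<dots> \<le> (\<Sum>q'\<in>ch q. dyad (lvl q') ^ k)"
    using ch_T[OF Suc.prems] by (intro sum_mono Suc.IH)
  finally show ?case using ch_mass[OF Suc.prems] by simp
qed simp

lemma meeting_mass_nonneg: "0 \<le> meeting_mass j q U"
  by (induction j arbitrary: q) (auto intro: sum_nonneg)

lemma meeting_mass_le: "q \<in> T \<Longrightarrow> meeting_mass j q U \<le> dyad (lvl q) ^ k"
proof (induction j arbitrary: q)
  case (Suc j)
  have "meeting_mass (Suc j) q U \<le> (\<Sum>q'\<in>ch q. dyad (lvl q') ^ k)"
    unfolding meeting_mass.simps using ch_T[OF Suc.prems] by (intro sum_mono Suc.IH)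
  then show ?case using ch_mass[OF Suc.prems] by simp
qed simp

lemma meeting_mass_eq_0: "q \<in> T \<Longrightarrow> body q \<inter> U = {} \<Longrightarrow> meeting_mass j q U = 0"
proof (induction j arbitrary: q)
  case (Suc j)
  have "meeting_mass j p U = 0" if "p \<in> ch q" for p
    using Suc.prems ch_body[OF Suc.prems(1) that] ch_T[OF Suc.prems(1) that]
    by (intro Suc.IH) auto
  then show ?case by simp
qed simp

text \<open>Each node at depth \<open>j\<close> counts in full for some \<open>W i\<close>, and
  conservation of mass carries this up to \<open>q\<close>.\<close>

lemma mass_le_sum_meeting_mass:
  assumes "finite I"
  shows "q \<in> T \<Longrightarrow> (\<And>p. p \<in> desc j q \<Longrightarrow> \<exists>i\<in>I. body p \<inter> W i \<noteq> {}) \<Longrightarrow>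
    dyad (lvl q) ^ k \<le> (\<Sum>i\<in>I. meeting_mass j q (W i))"
proof (induction j arbitrary: q)
  case 0
  then obtain i where i: "i \<in> I" "body q \<inter> W i \<noteq> {}" by auto
  then have "dyad (lvl q) ^ k \<le> meeting_mass 0 q (W i)" by simp
  also have "\<dots> \<le> (\<Sum>i\<in>I. meeting_mass 0 q (W i))"
    using assms i(1) meeting_mass_nonneg[of 0 q] by (intro member_le_sum) blast+
  finally show ?case .
next
  case (Suc j)
  have "dyad (lvl q) ^ k = (\<Sum>p\<in>ch q. dyad (lvl p) ^ k)" using ch_mass[OF Suc.prems(1)] by simp
  also have "\<dots> \<le> (\<Sum>p\<in>ch q. \<Sum>i\<in>I. meeting_mass j p (W i))"
    using Suc.prems ch_T[OF Suc.prems(1)] by (intro sum_mono Suc.IH) auto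
  also have "\<dots> = (\<Sum>i\<in>I. meeting_mass (Suc j) q (W i))"
    by (simp add: sum.swap[of _ "ch q" I])
  finally show ?case .
qed

text \<open>The separation condition for the larger of the two radii is used; its summand 2 then
  pays for both distances to the centres.\<close>

lemma closure_body_separated:
  assumes q: "q \<in> T" "p \<in> ch q" "p' \<in> ch q" "p \<noteq> p'"
    and u: "u \<in> closure (body p)" and v: "v \<in> closure (body p')"
  shows "2 ^ Suc (length (pre q)) * dyad (lvl p) \<le> dist u v"
proof -
  let ?s = "2 ^ Suc (length (pre q)) :: real"
  have 1: "?s * dyad (lvl p) + 2 * dyad (lvl p) \<le> dist (ctr p) (ctr p')"
    using ch_separated[OF q] by (simp only: distrib_right)
  have 2: "?s * dyad (lvl p') + 2 * dyad (lvl p') \<le> dist (ctr p) (ctr p')"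
    using ch_separated[OF q(1,3,2) q(4)[symmetric]] by (simp only: distrib_right dist_commute)
  have 3: "dist (ctr p) u \<le> dyad (lvl p)" "dist (ctr p') v \<le> dyad (lvl p')"
    using u v closure_body_cball[OF ch_T[OF q(1,2)]] closure_body_cball[OF ch_T[OF q(1,3)]]
    by (auto simp: subset_iff)
  have 4: "dist (ctr p) (ctr p') \<le> dist (ctr p) u + dist u v + dist (ctr p') v"
    using dist_triangle[of "ctr p" "ctr p'" u] dist_triangle[of u "ctr p'" v]
    by (simp add: dist_commute)
  show ?thesis
  proof (cases "dyad (lvl p') \<le> dyad (lvl p)")
    case True
    then show ?thesis using 1 3 4 by linarith
  next
    case False
    then have "?s * dyad (lvl p) \<le> ?s * dyad (lvl p')" by (intro mult_left_mono) auto
    then show ?thesis using False 2 3 4 by linarith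
  qed
qed

text \<open>Every generation below the node where two branches part at least halves the radii, which
  gains as much as a later parting would gain from the stronger separation. Hence the exponent
  depends only on the total depth.\<close>

lemma desc_separated:
  assumes "q \<in> T" "p \<in> desc j q" "p' \<in> desc j q" "p \<noteq> p'"
    and "u \<in> closure (body p)" "v \<in> closure (body p')"
  shows "2 ^ (length (pre q) + j) * dyad (lvl p) \<le> dist u v"
  using assms
proof (induction j arbitrary: q)
  case (Suc j)
  then obtain q1 q2 where q1: "q1 \<in> ch q" "p \<in> desc j q1" and q2: "q2 \<in> ch q" "p' \<in> desc j q2"
    by auto
  have T: "q1 \<in> T" "q2 \<in> T" using q1 q2 Suc.prems(1) ch_T by blast+
  show ?case
  proof (cases "q1 = q2")
    case True
    have "length (pre q1) = Suc (length (pre q))" using ch_pre[OF Suc.prems(1) q1(1)] by auto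
    then show ?thesis using Suc.IH[OF T(1) q1(2)] q2(2) True Suc.prems by simp
  next
    case False
    have "u \<in> closure (body q1)" "v \<in> closure (body q2)"
      using Suc.prems(5,6) closure_mono[OF desc_body[OF T(1) q1(2)]]
        closure_mono[OF desc_body[OF T(2) q2(2)]] by auto
    then have "2 ^ Suc (length (pre q)) * dyad (lvl q1) \<le> dist u v"
      using closure_body_separated[OF Suc.prems(1) q1(1) q2(1) False] by blast
    moreover have "dyad (lvl p) \<le> dyad (lvl q1 + j)"
      using desc_lvl[OF T(1) q1(2)] by (rule dyad_antimono)
    then have "2 ^ j * dyad (lvl p) \<le> 2 ^ j * dyad (lvl q1 + j)" by (intro mult_left_mono) auto
    then have "2 ^ j * dyad (lvl p) \<le> dyad (lvl q1)"
      by (simp add: dyad_def power_add power_one_over)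
    then have "2 ^ Suc (length (pre q)) * (2 ^ j * dyad (lvl p)) \<le> 2 ^ Suc (length (pre q)) * dyad (lvl q1)"
      by (intro mult_left_mono) auto
    moreover have "2 ^ (length (pre q) + Suc j) * dyad (lvl p) =
        2 ^ Suc (length (pre q)) * (2 ^ j * dyad (lvl p))"
      by (simp add: power_add mult_ac)
    ultimately show ?thesis by linarith
  qed
qed simp

text \<open>Descend from \<open>q\<close> as long as \<open>U\<close> meets a child larger than \<open>U\<close>, which is then the only child
  that it meets; afterwards the spread of the children bounds the mass.\<close>

lemma meeting_mass_le_scale:
  assumes m: "2 \<le> m" and U: "\<And>u v. u \<in> U \<Longrightarrow> v \<in> U \<Longrightarrow> dist u v \<le> dyad m"
    and q: "q \<in> T" "\<And>p. p \<in> desc j q \<Longrightarrow> m \<le> lvl p"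
  shows "meeting_mass j q U \<le> L * 4 ^ k * dyad m ^ k"
proof -
  have L4: "1 \<le> L * 4 ^ k" using L_ge_1 mult_mono[of 1 L 1 "4 ^ k"] by simp
  have high: "meeting_mass j q U \<le> L * 4 ^ k * dyad m ^ k" if "q \<in> T" "m \<le> lvl q" for q j
  proof -
    have "meeting_mass j q U \<le> dyad (lvl q) ^ k" by (rule meeting_mass_le[OF that(1)])
    also have "\<dots> \<le> 1 * dyad m ^ k" using that(2) by (simp add: power_mono dyad_antimono)
    also have "\<dots> \<le> L * 4 ^ k * dyad m ^ k" using L4 by (intro mult_right_mono) auto
    finally show ?thesis .
  qed
  show ?thesis using q
  proof (induction j arbitrary: q)
    case 0
    then have "m \<le> lvl q" by simp
    with 0(1) show ?case by (rule high)
  next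
    case (Suc j)
    define R where "R = {p \<in> ch q. body p \<inter> U \<noteq> {}}"
    have fin: "finite R" using finite_ch[OF Suc.prems(1)] unfolding R_def by simp
    have sum_R: "meeting_mass (Suc j) q U = (\<Sum>p\<in>R. meeting_mass j p U)"
      unfolding meeting_mass.simps R_def
      using finite_ch[OF Suc.prems(1)] meeting_mass_eq_0[OF ch_T[OF Suc.prems(1)]]
      by (intro sum.mono_neutral_right) auto
    have T: "p \<in> T" if "p \<in> R" for p using that Suc.prems(1) ch_T unfolding R_def by blast
    have lvl: "m \<le> lvl p'" if "p' \<in> desc j p" "p \<in> R" for p p'
      using that by (intro Suc.prems(2)) (auto simp: R_def)
    consider "R = {}" | p where "p \<in> R" "lvl p < m" | p where "p \<in> R" "\<And>p'. p' \<in> R \<Longrightarrow> m \<le> lvl p'"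
      by (metis equals0I not_le)
    then show ?case
    proof cases
      case 1
      then show ?thesis using sum_R L_ge_1 by simp
    next
      case (2 p)
      have "p' = p" if p': "p' \<in> R" for p'
      proof (rule ccontr)
        assume ne: "p' \<noteq> p"
        obtain u v where uv: "u \<in> body p" "u \<in> U" "v \<in> body p'" "v \<in> U"
          using 2(1) p' unfolding R_def by blast
        have "2 ^ Suc (length (pre q)) * dyad (lvl p) \<le> dist u v"
          using 2(1) p' ne uv(1,3) closure_subset[of "body p"] closure_subset[of "body p'"] Suc.prems(1)
          unfolding R_def by (intro closure_body_separated[of q p p']) auto
        also have "\<dots> \<le> dyad m" using uv by (intro U)
        finally have "2 ^ Suc (length (pre q)) * dyad (lvl p) \<le> dyad m" .
        moreover have "1 * dyad (lvl p) \<le> 2 ^ Suc (length (pre q)) * dyad (lvl p)"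
          by (intro mult_right_mono one_le_power) auto
        ultimately show False
          using dyad_less[OF 2(2)] dyad_pos[of m] by linarith
      qed
      then have "R = {p}" using 2(1) by blast
      then show ?thesis
        using sum_R Suc.IH[OF T[OF 2(1)]] lvl[of _ p] 2(1) by simp
    next
      case (3 p)
      \<comment> \<open>The centres of the children met lie within \<open>3 * dyad m\<close> of each
        other, hence in a test ball of radius \<open>4 * dyad m\<close>. This is where
        \<open>2 \<le> m\<close> is needed and where \<open>4 ^ k\<close> comes from.\<close>
      obtain l where l: "m = l + 2" using m by (metis le_add_diff_inverse2)
      have d: "dyad l = 4 * dyad m" unfolding l by (simp add: dyad_def)
      have "R \<subseteq> {p' \<in> ch q. l \<le> lvl p' \<and> dist (ctr p') (ctr p) < dyad l}"
      proof
        fix p' assume p': "p' \<in> R"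
        obtain u v where uv: "u \<in> body p" "u \<in> U" "v \<in> body p'" "v \<in> U"
          using 3(1) p' unfolding R_def by blast
        have "dist (ctr p) u \<le> dyad (lvl p)" "dist (ctr p') v \<le> dyad (lvl p')"
          using uv body_cball[OF T[OF 3(1)]] body_cball[OF T[OF p']] by (auto simp: subset_iff)
        moreover have "dyad (lvl p) \<le> dyad m" "dyad (lvl p') \<le> dyad m"
          using 3 p' by (auto intro: dyad_antimono)
        moreover have "dist u v \<le> dyad m" using uv by (intro U)
        moreover have "dist (ctr p') (ctr p) \<le> dist (ctr p) u + dist u v + dist (ctr p') v"
          using dist_triangle[of "ctr p'" "ctr p" v] dist_triangle[of v "ctr p" u]
          by (simp add: dist_commute)
        ultimately have "dist (ctr p') (ctr p) < dyad l"
          unfolding d using dyad_pos[of m] by linarith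
        then show "p' \<in> {p' \<in> ch q. l \<le> lvl p' \<and> dist (ctr p') (ctr p) < dyad l}"
          using p' 3(2)[OF p'] l unfolding R_def by simp
      qed
      then have "(\<Sum>p\<in>R. dyad (lvl p) ^ k) \<le>
          (\<Sum>p' | p' \<in> ch q \<and> l \<le> lvl p' \<and> dist (ctr p') (ctr p) < dyad l. dyad (lvl p') ^ k)"
        using finite_ch[OF Suc.prems(1)] by (intro sum_mono2) auto
      also have "\<dots> \<le> L * dyad l ^ k"
        using Suc.prems(1) ctr_K[OF T[OF 3(1)]] by (intro ch_spread)
      also have "\<dots> = L * 4 ^ k * dyad m ^ k" unfolding d by (simp add: power_mult_distrib)
      finally have "(\<Sum>p\<in>R. dyad (lvl p) ^ k) \<le> L * 4 ^ k * dyad m ^ k" .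
      moreover have "(\<Sum>p\<in>R. meeting_mass j p U) \<le> (\<Sum>p\<in>R. dyad (lvl p) ^ k)"
        using T by (intro sum_mono meeting_mass_le)
      ultimately show ?thesis using sum_R by linarith
    qed
  qed
qed

section \<open>Layers and the limit set\<close>

lemma layer_Suc: "layer (Suc j) q = (\<Union>p\<in>ch q. layer j p)"
  unfolding layer_def by simp

lemma layer_Suc_subset: "q \<in> T \<Longrightarrow> layer (Suc j) q \<subseteq> layer j q"
proof (induction j arbitrary: q)
  case 0
  then show ?case unfolding layer_def using closure_mono[OF ch_body[OF 0]] by auto
next
  case (Suc j)
  then have "layer (Suc j) p \<subseteq> layer j p" if "p \<in> ch q" for p
    using that ch_T[OF Suc.prems] Suc.IH by blast
  then show ?case unfolding layer_Suc[of "Suc j"] layer_Suc[of j q] by blast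
qed

lemma layer_antimono: "q \<in> T \<Longrightarrow> i \<le> j \<Longrightarrow> layer j q \<subseteq> layer i q"
  by (rule lift_Suc_antimono_le[of "\<lambda>j. layer j q"]) (auto dest: layer_Suc_subset)

lemma closed_layer: "q \<in> T \<Longrightarrow> closed (layer j q)"
  unfolding layer_def using finite_desc by (intro closed_UN) auto

lemma closed_cantor_set: "closed cantor_set"
  unfolding cantor_set_def using closed_layer root by (intro closed_INT) auto

lemma dist_closure_body_le:
  assumes "q \<in> T" "u \<in> closure (body q)" "v \<in> closure (body q)"
  shows "dist u v \<le> 2 * dyad (lvl q)"
proof -
  have "dist (ctr q) u \<le> dyad (lvl q)" "dist (ctr q) v \<le> dyad (lvl q)"
    using assms closure_body_cball[OF assms(1)] by auto
  then show ?thesis using dist_triangle[of u v "ctr q"] by (simp add: dist_commute)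
qed

text \<open>Stated for part of a generation: the whole generation bounds the measure of
  \<open>cantor_set\<close>, and the nodes met by a Lipschitz image bound that of its intersection
  with the image.\<close>

lemma cantor_subset_premeasure_le:
  assumes Q: "Q \<subseteq> desc j root" and S: "S \<subseteq> (\<Union>q\<in>Q. closure (body q))" and j: "2 * dyad j \<le> \<delta>"
  shows "hausdorff_premeasure k \<delta> S \<le> ennreal (2 ^ k * (\<Sum>q\<in>Q. dyad (lvl q) ^ k))"
proof -
  have fQ: "finite Q" using Q finite_desc[OF root(1)] by (rule finite_subset)
  have QT: "q \<in> T" if "q \<in> Q" for q using that Q desc_T root by blast
  show ?thesis
  proof (rule hausdorff_premeasure_le_family[OF _ S])
    show "countable Q" using fQ by (rule countable_finite)
  next
    fix q assume q: "q \<in> Q"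
    have "dyad (lvl q) \<le> dyad j"
      using desc_lvl[OF root(1), of q j] q Q by (intro dyad_antimono) auto
    then have "2 * dyad (lvl q) \<le> \<delta>" using j by simp
    then show "ediameter (closure (body q)) \<le> ennreal \<delta>"
      using dist_closure_body_le[OF QT[OF q]] by (intro ediameter_le) (meson order_trans)
  next
    fix Q' assume Q': "finite Q'" "Q' \<subseteq> Q"
    have "(\<Sum>q\<in>Q'. hausdorff_weight k (closure (body q))) \<le> (\<Sum>q\<in>Q'. ennreal ((2 * dyad (lvl q)) ^ k))"
      using Q' QT dist_closure_body_le by (intro sum_mono hausdorff_weight_le) auto
    also have "\<dots> = ennreal (2 ^ k * (\<Sum>q\<in>Q'. dyad (lvl q) ^ k))"
      by (subst sum_ennreal) (auto simp: sum_distrib_left power_mult_distrib)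
    also have "\<dots> \<le> ennreal (2 ^ k * (\<Sum>q\<in>Q. dyad (lvl q) ^ k))"
      using Q' fQ by (intro ennreal_leI mult_left_mono sum_mono2) auto
    finally show "(\<Sum>q\<in>Q'. hausdorff_weight k (closure (body q))) \<le>
      ennreal (2 ^ k * (\<Sum>q\<in>Q. dyad (lvl q) ^ k))" .
  qed
qed

lemma hausdorff_measure_cantor_set_finite: "hausdorff_measure k cantor_set < \<infinity>"
proof -
  have "hausdorff_premeasure k \<delta> cantor_set \<le> ennreal (2 ^ k * dyad (lvl root) ^ k)" if \<delta>: "0 < \<delta>" for \<delta>
  proof -
    obtain j where j: "2 * dyad j \<le> \<delta>"
      using eventually_happens[OF eventually_dyad_le[OF \<delta>, of 2]] by auto
    have "cantor_set \<subseteq> (\<Union>q\<in>desc j root. closure (body q))"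
      unfolding cantor_set_def layer_def by blast
    from cantor_subset_premeasure_le[OF order_refl this j]
    show ?thesis
      using sum_desc_le[OF root(1), of j] by (elim order_trans) (intro ennreal_leI mult_left_mono, auto)
  qed
  then have "hausdorff_measure k cantor_set \<le> ennreal (2 ^ k * dyad (lvl root) ^ k)"
    by (rule hausdorff_measure_le)
  then show ?thesis by (auto intro: le_less_trans)
qed

text \<open>A mass distribution principle in finite form. Masses exist at finite depth only, so a
  cover of small weight has to be made open and then finite before it can be compared with
  them.\<close>

lemma hausdorff_measure_cantor_set_pos: "0 < hausdorff_measure k cantor_set"
proof (rule ccontr)
  assume "\<not> ?thesis"
  then have null: "hausdorff_premeasure k 1 cantor_set = 0"
    using hausdorff_premeasure_le_measure[of 1 k cantor_set] by (simp add: not_less)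
  let ?c = "dyad (lvl root) ^ k" and ?C = "L * 4 ^ k"
  \<comment> \<open>Makes \<open>?C * (2 ^ k * \<tau> + \<tau>)\<close> half the mass of the root:
    \<open>2 ^ k * \<tau>\<close> for the rounded weights, \<open>\<tau>\<close> for the geometric
    errors of the enlargements.\<close>
  define \<tau> where "\<tau> = ?c / (2 * ?C * (2 ^ k + 1))"
  have C: "0 < ?C" using L_ge_1 by simp
  have P: "0 < (2::real) ^ k + 1" by (simp add: add_pos_pos)
  have \<tau>: "0 < \<tau>" unfolding \<tau>_def using C P by simp
  have \<tau>_eq: "2 ^ k * \<tau> + \<tau> = ?c / (2 * ?C)"
  proof -
    have "(2 ^ k + 1) * \<tau> = ?c / (2 * ?C)" unfolding \<tau>_def using P by simp
    then show ?thesis by (simp add: distrib_right)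
  qed
  have c1: "?c \<le> 1" by (simp add: power_le_one dyad_def)
  have "?c / (2 * ?C) \<le> 1 / (2 * 4 ^ k)"
    using c1 L_ge_1 by (intro frac_le) auto
  also have "\<dots> < (1 / 2) ^ k"
  proof -
    have "(2::real) ^ k \<le> 4 ^ k" by (intro power_mono) auto
    moreover have "(0::real) < 4 ^ k" by simp
    ultimately have "(2::real) ^ k < 2 * 4 ^ k" by linarith
    then show ?thesis by (simp add: power_one_over frac_less2)
  qed
  \<comment> \<open>Puts every scale \<open>m i\<close> at 2 or beyond, as
    \<open>meeting_mass_le_scale\<close> demands.\<close>
  finally have small: "2 ^ k * \<tau> + \<tau> < dyad 1 ^ k" unfolding \<tau>_eq by (simp add: dyad_def)
  have "dyad 1 ^ k \<le> 1" by (simp add: power_le_one dyad_def)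
  moreover have "0 \<le> 2 ^ k * \<tau>" using \<tau> by simp
  ultimately have \<tau>1: "\<tau> < 1" using small by linarith
  have "0 < ennreal \<tau>" using \<tau> by simp
  then obtain U :: "nat \<Rightarrow> 'a set" where U: "cantor_set \<subseteq> (\<Union>i. U i)"
    "(\<Sum>i. hausdorff_weight k (U i)) < ennreal \<tau>"
    unfolding null[symmetric] hausdorff_premeasure_def Inf_less_iff by blast
  let ?w = "\<lambda>i. hausdorff_weight k (U i)"
  have sum_w: "(\<Sum>i\<in>I. ?w i) < ennreal \<tau>" if "finite I" for I
    using U(2) sum_le_suminf[of ?w I] that by (auto intro: le_less_trans)
  have w1: "?w i < 1" for i
  proof -
    have "?w i < ennreal \<tau>" using sum_w[of "{i}"] by simp
    also have "\<dots> < 1" using \<tau>1 \<tau> ennreal_less_iff[of \<tau> 1] by simp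
    finally show ?thesis .
  qed
  define Good where "Good i m W \<longleftrightarrow> open W \<and> U i \<subseteq> W \<and> (\<forall>u\<in>W. \<forall>v\<in>W. dist u v \<le> dyad m) \<and>
    dyad m ^ k \<le> 2 ^ k * enn2real (?w i) + \<tau> * (1 / 2) ^ Suc i" for i m W
  have "\<exists>m W. Good i m W" for i
  proof -
    have "0 < \<tau> * (1 / 2) ^ Suc i" using \<tau> by simp
    then show ?thesis
      using open_enlargement[OF k_pos w1[of i]] unfolding Good_def by metis
  qed
  then obtain m W where mW: "\<And>i. Good i (m i) (W i)" by metis
  have W: "open (W i)" "U i \<subseteq> W i" "\<And>u v. u \<in> W i \<Longrightarrow> v \<in> W i \<Longrightarrow> dist u v \<le> dyad (m i)"
    "dyad (m i) ^ k \<le> 2 ^ k * enn2real (?w i) + \<tau> * (1 / 2) ^ Suc i" for i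
    using mW[of i] unfolding Good_def by auto
  \<comment> \<open>Bodies may contain points outside \<open>cantor_set\<close>, but such points
    leave some layer. Complements of the closed layers complete an open cover of \<open>K\<close>;
    those in the finite subcover are disjoint from all bodies of sufficient depth.\<close>
  have "K \<subseteq> (\<Union>i\<in>UNIV. W i \<union> - layer i root)"
  proof
    fix x
    show "x \<in> (\<Union>i\<in>UNIV. W i \<union> - layer i root)"
    proof (cases "x \<in> cantor_set")
      case True
      then show ?thesis using U(1) W(2) by blast
    next
      case False
      then show ?thesis unfolding cantor_set_def by blast
    qed
  qed
  moreover have "open (W i \<union> - layer i root)" for i
    using W(1) closed_layer[OF root(1)] by (intro open_Un) auto
  ultimately obtain I where I: "finite I" "K \<subseteq> (\<Union>i\<in>I. W i \<union> - layer i root)"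
    using compactE_image[OF K, of UNIV "\<lambda>i. W i \<union> - layer i root"] by metis
  \<comment> \<open>Depth beyond the indices in \<open>I\<close> rules out the complements of
    layers; depth beyond the \<open>m i\<close> makes all nodes at least as fine as the enlarged
    sets.\<close>
  define j where "j = Max (insert 0 (I \<union> m ` I))"
  have j: "i \<le> j" "m i \<le> j" if "i \<in> I" for i
    using I(1) that unfolding j_def by (auto intro!: Max_ge)
  have "\<exists>i\<in>I. body p \<inter> W i \<noteq> {}" if p: "p \<in> desc j root" for p
  proof -
    have pT: "p \<in> T" using p desc_T root by blast
    then obtain u where u: "u \<in> body p" using body_nonempty by blast
    then have "u \<in> layer j root" using p closure_subset unfolding layer_def by blast
    then have "u \<in> layer i root" if "i \<in> I" for i
      using layer_antimono[OF root(1) j(1)[OF that]] by blast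
    moreover have "u \<in> K" using u pT body_K by blast
    ultimately show ?thesis using I(2) u by blast
  qed
  then have "?c \<le> (\<Sum>i\<in>I. meeting_mass j root (W i))"
    using I(1) root by (intro mass_le_sum_meeting_mass)
  also have "\<dots> \<le> (\<Sum>i\<in>I. ?C * dyad (m i) ^ k)"
  proof (rule sum_mono)
    fix i assume i: "i \<in> I"
    have "?w i \<le> ennreal \<tau>" using sum_w[of "{i}"] by simp
    then have "enn2real (?w i) \<le> \<tau>" using \<tau> by (simp add: enn2real_leI)
    then have "2 ^ k * enn2real (?w i) \<le> 2 ^ k * \<tau>" by (rule mult_left_mono) simp
    moreover have "\<tau> * (1 / 2) ^ Suc i \<le> \<tau> * 1" using \<tau> by (intro mult_left_mono power_le_one) auto
    ultimately have "2 ^ k * enn2real (?w i) + \<tau> * (1 / 2) ^ Suc i \<le> 2 ^ k * \<tau> + \<tau>"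
      by linarith
    then have "dyad (m i) ^ k < dyad 1 ^ k" using W(4)[of i] small by linarith
    then have "dyad (m i) < dyad 1" by (rule power_less_imp_less_base) simp
    then have "2 \<le> m i" using dyad_antimono[of "m i" 1] by (cases "m i \<le> 1") auto
    moreover have "m i \<le> lvl p" if "p \<in> desc j root" for p
      using desc_lvl[OF root(1) that] j(2)[OF i] by simp
    ultimately show "meeting_mass j root (W i) \<le> ?C * dyad (m i) ^ k"
      using W(3)[of _ i] root(1) by (intro meeting_mass_le_scale) auto
  qed
  also have "\<dots> = ?C * (\<Sum>i\<in>I. dyad (m i) ^ k)" by (simp add: sum_distrib_left)
  also have "\<dots> \<le> ?C * (2 ^ k * \<tau> + \<tau>)"
  proof (intro mult_left_mono)
    have "(\<Sum>i\<in>I. dyad (m i) ^ k) \<le> (\<Sum>i\<in>I. 2 ^ k * enn2real (?w i) + \<tau> * (1 / 2) ^ Suc i)"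
      by (intro sum_mono W)
    also have "\<dots> = 2 ^ k * (\<Sum>i\<in>I. enn2real (?w i)) + \<tau> * (\<Sum>i\<in>I. (1 / 2) ^ Suc i)"
      by (simp only: sum.distrib sum_distrib_left)
    also have "\<dots> \<le> 2 ^ k * \<tau> + \<tau> * 1"
    proof (intro add_mono mult_left_mono)
      have "(\<Sum>i\<in>I. ennreal (enn2real (?w i))) = (\<Sum>i\<in>I. ?w i)"
        by (intro sum.cong refl ennreal_enn2real less_trans[OF w1]) simp
      then have "ennreal (\<Sum>i\<in>I. enn2real (?w i)) < ennreal \<tau>"
        using sum_w[OF I(1)] by (subst sum_ennreal[symmetric]) auto
      then show "(\<Sum>i\<in>I. enn2real (?w i)) \<le> \<tau>" using \<tau> by (simp add: ennreal_less_iff sum_nonneg)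
      show "(\<Sum>i\<in>I. (1 / 2) ^ Suc i) \<le> (1::real)"
        using sum_le_suminf[of "\<lambda>i. (1 / 2 :: real) ^ Suc i" I] power_half_series I(1)
        by (auto simp: sums_iff)
    qed (use \<tau> in auto)
    finally show "(\<Sum>i\<in>I. dyad (m i) ^ k) \<le> 2 ^ k * \<tau> + \<tau>" by simp
  qed (use C in simp)
  also have "\<dots> = ?c / 2" unfolding \<tau>_eq using L_ge_1 by simp
  finally show False using zero_less_power[OF dyad_pos[of "lvl root"], of k] by simp
qed

text \<open>Koenig's lemma: a node has finitely many children and layers decrease, so if every child
  lost \<open>z\<close> at some depth, the node itself would lose it. The result is a single index
  sequence for \<open>z\<close>, as membership in a Souslin set requires.\<close>

lemma cantor_set_branch:
  assumes z: "z \<in> cantor_set"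
  obtains \<sigma> where "\<And>n. \<exists>p\<in>T. pre p = map \<sigma> [0..<n] \<and> z \<in> closure (body p)"
proof -
  define V where "V q \<longleftrightarrow> q \<in> T \<and> (\<forall>j. z \<in> layer j q)" for q
  have step: "\<exists>p. V p \<and> p \<in> ch q" if V: "V q" for q
  proof (rule ccontr)
    assume contr: "\<not> ?thesis"
    have qT: "q \<in> T" and zq: "\<And>j. z \<in> layer j q" using V unfolding V_def by auto
    have "\<forall>p\<in>ch q. \<exists>j. z \<notin> layer j p" using contr ch_T[OF qT] unfolding V_def by blast
    then obtain j where j: "\<And>p. p \<in> ch q \<Longrightarrow> z \<notin> layer (j p) p" by metis
    define J where "J = Max (insert 0 (j ` ch q))"
    obtain p where p: "p \<in> ch q" "z \<in> layer J p" using zq[of "Suc J"] unfolding layer_Suc by blast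
    have "j p \<le> J" unfolding J_def using p(1) finite_ch[OF qT] by (intro Max_ge) auto
    then show False using layer_antimono[OF ch_T[OF qT p(1)]] p j by blast
  qed
  have "V root" using z root unfolding V_def cantor_set_def by blast
  then have "\<exists>f. \<forall>n. (V (f n) \<and> length (pre (f n)) = n) \<and> f (Suc n) \<in> ch (f n)"
    using root(2)
  proof (intro dependent_nat_choice)
    fix q n assume q: "V q \<and> length (pre q) = n"
    then obtain p where p: "V p" "p \<in> ch q" using step by blast
    then have "length (pre p) = Suc n" using q ch_pre[of q p] unfolding V_def by auto
    then show "\<exists>p. (V p \<and> length (pre p) = Suc n) \<and> p \<in> ch q" using p by blast
  qed auto
  then obtain f where f: "\<And>n. V (f n)" "\<And>n. length (pre (f n)) = n" "\<And>n. f (Suc n) \<in> ch (f n)"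
    by blast
  define \<sigma> where "\<sigma> n = last (pre (f (Suc n)))" for n
  have pre: "pre (f n) = map \<sigma> [0..<n]" for n
  proof (induction n)
    case 0
    then show ?case using f(2)[of 0] by simp
  next
    case (Suc n)
    obtain i where "pre (f (Suc n)) = pre (f n) @ [i]"
      using ch_pre[OF _ f(3)] f(1) unfolding V_def by blast
    then show ?case using Suc unfolding \<sigma>_def by simp
  qed
  have "\<exists>p\<in>T. pre p = map \<sigma> [0..<n] \<and> z \<in> closure (body p)" for n
  proof -
    have "f n \<in> T" "z \<in> layer 0 (f n)" using f(1)[of n] unfolding V_def by auto
    then show ?thesis using pre[of n] unfolding layer_def by auto
  qed
  then show ?thesis using that by blast
qed

text \<open>The preimages of the nodes of depth \<open>j\<close> are so far apart that they are contained in disjoint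
  balls whose radii exceed the diameters of the nodes by a factor of order \<open>2 ^ j\<close>.\<close>

lemma cantor_set_Lipschitz_image_null:
  fixes f :: "real ^ 'n \<Rightarrow> 'a"
  assumes kn: "k = CARD('n)" and f: "C-lipschitz_on B f" and C: "1 \<le> C" and B: "B \<subseteq> ball 0 r"
  shows "hausdorff_measure k (cantor_set \<inter> f ` B) = 0"
proof -
  let ?S = "cantor_set \<inter> f ` B"
  have key: "hausdorff_premeasure k \<delta> ?S \<le> ennreal ((4 * C * (\<bar>r\<bar> + 1) * dyad j) ^ k)"
    if \<delta>: "2 * dyad j \<le> \<delta>" for j \<delta>
  proof -
    define Q where "Q = {q \<in> desc j root. \<exists>b\<in>B. f b \<in> closure (body q)}"
    have fQ: "finite Q" unfolding Q_def using finite_desc[OF root(1)] by simp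
    have "\<forall>q\<in>Q. \<exists>b\<in>B. f b \<in> closure (body q)" unfolding Q_def by blast
    then obtain b where b: "\<And>q. q \<in> Q \<Longrightarrow> b q \<in> B" "\<And>q. q \<in> Q \<Longrightarrow> f (b q) \<in> closure (body q)"
      by metis
    \<comment> \<open>Half of the separation, pulled back by the Lipschitz constant. Equivalently
      \<open>dyad (lvl q) = 2 * C * dyad j * \<rho> q\<close>, so bounded total volume of the balls
      makes the total mass of the nodes tend to 0 with \<open>dyad j\<close>.\<close>
    define \<rho> where "\<rho> q = 2 ^ j * dyad (lvl q) / (2 * C)" for q :: "'a node"
    have \<rho>0: "0 \<le> \<rho> q" for q unfolding \<rho>_def using C by simp
    have \<rho>1: "\<rho> q \<le> 1" if "q \<in> Q" for q
    proof -
      have "dyad (lvl q) \<le> dyad j"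
        using desc_lvl[OF root(1), of q j] that unfolding Q_def by (intro dyad_antimono) auto
      then have "2 ^ j * dyad (lvl q) \<le> 2 ^ j * dyad j" by (intro mult_left_mono) auto
      also have "\<dots> = 1" by (simp add: dyad_def power_one_over)
      finally show ?thesis unfolding \<rho>_def using C by (simp add: pos_divide_le_eq)
    qed
    have far: "\<rho> q + \<rho> q' \<le> dist (b q) (b q')" if q: "q \<in> Q" "q' \<in> Q" "q \<noteq> q'" for q q'
    proof -
      have "dist (f (b q)) (f (b q')) \<le> C * dist (b q) (b q')"
        using f b q by (intro lipschitz_onD) auto
      moreover have "2 ^ j * dyad (lvl q) \<le> dist (f (b q)) (f (b q'))"
        using desc_separated[OF root(1), of q j q'] q b root(2) unfolding Q_def by simp
      moreover have "2 ^ j * dyad (lvl q') \<le> dist (f (b q')) (f (b q))"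
        using desc_separated[OF root(1), of q' j q] q b root(2) unfolding Q_def by simp
      ultimately have "2 ^ j * dyad (lvl q) + 2 ^ j * dyad (lvl q') \<le> dist (b q) (b q') * (2 * C)"
        by (simp add: dist_commute mult_ac)
      then show ?thesis unfolding \<rho>_def using C by (simp add: pos_divide_le_eq flip: add_divide_distrib)
    qed
    have disj: "disjoint_family_on (\<lambda>q. ball (b q) (\<rho> q)) Q"
      unfolding disjoint_family_on_def
    proof safe
      fix q q' x assume q: "q \<in> Q" "q' \<in> Q" "q \<noteq> q'" and "x \<in> ball (b q) (\<rho> q)" "x \<in> ball (b q') (\<rho> q')"
      then have "dist (b q) (b q') < \<rho> q + \<rho> q'"
        using dist_triangle[of "b q" "b q'" x] by (simp add: dist_commute)
      then show "x \<in> {}" using far[OF q] by simp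
    qed
    let ?v = "unit_ball_vol (real k)"
    have "(\<Sum>q\<in>Q. ?v * \<rho> q ^ k) = (\<Sum>q\<in>Q. measure lborel (ball (b q) (\<rho> q)))"
      using \<rho>0 by (intro sum.cong refl) (simp add: content_ball kn)
    also have "\<dots> = measure lborel (\<Union>q\<in>Q. ball (b q) (\<rho> q))"
      using fQ disj emeasure_bounded_finite[OF bounded_ball]
      by (intro measure_finite_Union[symmetric]) (auto simp: less_top)
    also have "\<dots> \<le> measure lborel (ball (0 :: real ^ 'n) (\<bar>r\<bar> + 1))"
    proof (rule measure_mono_fmeasurable)
      show "(\<Union>q\<in>Q. ball (b q) (\<rho> q)) \<subseteq> ball 0 (\<bar>r\<bar> + 1)"
      proof safe
        fix q x assume q: "q \<in> Q" "x \<in> ball (b q) (\<rho> q)"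
        have "norm (b q) < r" using b(1)[OF q(1)] B by auto
        moreover have "norm (x - b q) < \<rho> q" using q(2) by (simp add: dist_norm norm_minus_commute)
        moreover have "norm x \<le> norm (b q) + norm (x - b q)" using norm_triangle_sub by blast
        ultimately show "x \<in> ball 0 (\<bar>r\<bar> + 1)" using \<rho>1[OF q(1)] by simp
      qed
    qed (auto intro!: fmeasurableI emeasure_bounded_finite borel_open open_UN)
    also have "\<dots> = ?v * (\<bar>r\<bar> + 1) ^ k" by (simp add: content_ball kn)
    finally have "?v * (\<Sum>q\<in>Q. \<rho> q ^ k) \<le> ?v * (\<bar>r\<bar> + 1) ^ k" by (simp add: sum_distrib_left)
    then have "(\<Sum>q\<in>Q. \<rho> q ^ k) \<le> (\<bar>r\<bar> + 1) ^ k" by (simp add: mult_le_cancel_left)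
    moreover have "dyad (lvl q) = 2 * C * dyad j * \<rho> q" for q
      unfolding \<rho>_def using C by (simp add: dyad_def power_one_over)
    then have "(\<Sum>q\<in>Q. dyad (lvl q) ^ k) = (2 * C * dyad j) ^ k * (\<Sum>q\<in>Q. \<rho> q ^ k)"
      by (simp add: sum_distrib_left power_mult_distrib)
    ultimately have "(\<Sum>q\<in>Q. dyad (lvl q) ^ k) \<le> (2 * C * dyad j) ^ k * (\<bar>r\<bar> + 1) ^ k"
      using C by (simp add: mult_left_mono)
    then have "2 ^ k * (\<Sum>q\<in>Q. dyad (lvl q) ^ k) \<le> 2 ^ k * ((2 * C * dyad j) ^ k * (\<bar>r\<bar> + 1) ^ k)"
      by (rule mult_left_mono) simp
    also have "\<dots> = (4 * C * (\<bar>r\<bar> + 1) * dyad j) ^ k"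
      by (simp add: mult_ac flip: power_mult_distrib)
    finally have sum_le: "2 ^ k * (\<Sum>q\<in>Q. dyad (lvl q) ^ k) \<le> (4 * C * (\<bar>r\<bar> + 1) * dyad j) ^ k" .
    have "?S \<subseteq> (\<Union>q\<in>Q. closure (body q))"
    proof
      fix x assume x: "x \<in> ?S"
      then obtain q where "q \<in> desc j root" "x \<in> closure (body q)"
        unfolding cantor_set_def layer_def by blast
      then show "x \<in> (\<Union>q\<in>Q. closure (body q))" using x unfolding Q_def by blast
    qed
    then have "hausdorff_premeasure k \<delta> ?S \<le> ennreal (2 ^ k * (\<Sum>q\<in>Q. dyad (lvl q) ^ k))"
      using \<delta> unfolding Q_def by (intro cantor_subset_premeasure_le[of _ j]) auto
    also have "\<dots> \<le> ennreal ((4 * C * (\<bar>r\<bar> + 1) * dyad j) ^ k)" using sum_le by (rule ennreal_leI)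
    finally show ?thesis .
  qed
  have "hausdorff_premeasure k \<delta> ?S \<le> 0" if \<delta>: "0 < \<delta>" for \<delta>
  proof (rule tendsto_lowerbound)
    have "(\<lambda>j. (4 * C * (\<bar>r\<bar> + 1) * dyad j) ^ k) \<longlonglongrightarrow> (4 * C * (\<bar>r\<bar> + 1) * 0) ^ k"
      by (intro tendsto_intros dyad_tendsto_0)
    then have "(\<lambda>j. ennreal ((4 * C * (\<bar>r\<bar> + 1) * dyad j) ^ k)) \<longlonglongrightarrow> ennreal ((4 * C * (\<bar>r\<bar> + 1) * 0) ^ k)"
      by (rule tendsto_ennrealI)
    then show "(\<lambda>j. ennreal ((4 * C * (\<bar>r\<bar> + 1) * dyad j) ^ k)) \<longlonglongrightarrow> 0"
      using k_pos by (simp add: zero_power)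
    show "\<forall>\<^sub>F j in sequentially. hausdorff_premeasure k \<delta> ?S \<le> ennreal ((4 * C * (\<bar>r\<bar> + 1) * dyad j) ^ k)"
      using eventually_dyad_le[OF \<delta>, of 2] by (rule eventually_mono) (rule key)
  qed simp
  then have "hausdorff_measure k ?S \<le> 0" by (rule hausdorff_measure_le)
  then show ?thesis by simp
qed

text \<open>Comparing volumes requires a bounded domain, so \<open>B\<close> is exhausted by its
  intersections with balls. The Lipschitz constant is raised to at least 1, which keeps the radii of
  the pulled-back balls finite and at most 1.\<close>

lemma purely_unrectifiable_cantor_set:
  assumes kn: "k = CARD('n::finite)"
  shows "purely_unrectifiable TYPE('n) cantor_set"
  unfolding purely_unrectifiable_def
proof (intro ballI allI impI)
  fix B :: "(real ^ 'n) set" and f :: "real ^ 'n \<Rightarrow> 'a"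
  assume "\<exists>L. L-lipschitz_on B f"
  then obtain C where "C-lipschitz_on B f" by blast
  then have C: "(max 1 C)-lipschitz_on B f" by (rule lipschitz_on_le) simp
  have "hausdorff_measure k (cantor_set \<inter> f ` (B \<inter> ball 0 (real r))) = 0" for r :: nat
    using lipschitz_on_subset[OF C, of "B \<inter> ball 0 (real r)"] kn
    by (intro cantor_set_Lipschitz_image_null[of "max 1 C" _ _ "real r"]) auto
  then have "hausdorff_measure k (\<Union>r. cantor_set \<inter> f ` (B \<inter> ball 0 (real r))) = 0"
    by (rule hausdorff_measure_UN_null)
  moreover have "cantor_set \<inter> f ` B \<subseteq> (\<Union>r. cantor_set \<inter> f ` (B \<inter> ball 0 (real r)))"
  proof
    fix x assume "x \<in> cantor_set \<inter> f ` B"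
    then obtain b where b: "x \<in> cantor_set" "b \<in> B" "x = f b" by blast
    obtain r :: nat where "norm b < real r" using reals_Archimedean2 by blast
    then show "x \<in> (\<Union>r. cantor_set \<inter> f ` (B \<inter> ball 0 (real r)))"
      using b by (intro UN_I[of r]) auto
  qed
  ultimately show "hausdorff_measure CARD('n) (cantor_set \<inter> f ` B) = 0"
    using hausdorff_measure_mono kn by (metis le_zero_eq)
qed

end

section \<open>Souslin sets\<close>

text \<open>Unlike the closed sets \<open>C s\<close>, these pieces decompose exactly when
  \<open>s\<close> is extended, so content can be handed down from a piece to its
  refinements.\<close>

definition souslin_part :: "(nat list \<Rightarrow> 'a set) \<Rightarrow> nat list \<Rightarrow> 'a set" where
  "souslin_part C s = (\<Union>\<sigma> \<in> {\<sigma> :: nat \<Rightarrow> nat. map \<sigma> [0..<length s] = s}. \<Inter>n. C (map \<sigma> [0..<Suc n]))"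

lemma souslin_part_Nil: "souslin_part C [] = (\<Union>\<sigma>. \<Inter>n. C (map \<sigma> [0..<Suc n]))"
  by (simp add: souslin_part_def)

lemma souslin_part_append: "souslin_part C s = (\<Union>i. souslin_part C (s @ [i]))"
proof (intro equalityI subsetI)
  fix x assume "x \<in> souslin_part C s"
  then obtain \<sigma> where \<sigma>: "map \<sigma> [0..<length s] = s" "x \<in> (\<Inter>n. C (map \<sigma> [0..<Suc n]))"
    unfolding souslin_part_def by blast
  then have "map \<sigma> [0..<length (s @ [\<sigma> (length s)])] = s @ [\<sigma> (length s)]" by simp
  then have "x \<in> souslin_part C (s @ [\<sigma> (length s)])"
    using \<sigma>(2) unfolding souslin_part_def by blast
  then show "x \<in> (\<Union>i. souslin_part C (s @ [i]))" by blast
next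
  fix x assume "x \<in> (\<Union>i. souslin_part C (s @ [i]))"
  then obtain i \<sigma> where \<sigma>: "map \<sigma> [0..<length (s @ [i])] = s @ [i]" "x \<in> (\<Inter>n. C (map \<sigma> [0..<Suc n]))"
    unfolding souslin_part_def by blast
  then have "map \<sigma> [0..<length s] = s" by simp
  then show "x \<in> souslin_part C s" using \<sigma>(2) unfolding souslin_part_def by blast
qed

text \<open>The Souslin operation evaluates \<open>C\<close> on nonempty segments only, so
  \<open>C []\<close> is unconstrained; a nonempty \<open>s\<close> is the segment with index
  \<open>length s - 1\<close>.\<close>

lemma souslin_part_subset:
  assumes "s \<noteq> []" shows "souslin_part C s \<subseteq> C s"
proof
  fix x assume "x \<in> souslin_part C s"
  then obtain \<sigma> where \<sigma>: "map \<sigma> [0..<length s] = s" "x \<in> (\<Inter>n. C (map \<sigma> [0..<Suc n]))"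
    unfolding souslin_part_def by blast
  from \<sigma>(2) have "x \<in> C (map \<sigma> [0..<Suc (length s - 1)])" by blast
  then show "x \<in> C s" using \<sigma>(1) assms by simp
qed

text \<open>\<open>T\<close> collects all potential nodes, not only those reached from the root, so
  that one choice of children defines \<open>ch\<close> on all of it. The lower bound on the content
  of a body is the invariant that \<open>packing_step\<close> hands from parent to child.\<close>

lemma souslin_not_sigma_finite_has_cantor_tree:
  fixes K :: "'a::metric_space set" and C :: "nat list \<Rightarrow> 'a set"
  assumes k: "0 < k" and K: "compact K"
    and nsf: "\<not> hausdorff_sigma_finite k (souslin_part C [] \<inter> K)"
  obtains T root ch where "cantor_tree k (12 ^ k * 2 ^ Suc k + 2) K T root ch"
    "\<And>q. q \<in> T \<Longrightarrow> body q \<subseteq> souslin_part C (pre q)"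
proof -
  let ?low = "\<lambda>n. ennreal (dyad n ^ k / 2 ^ Suc k)"
  let ?L = "12 ^ k * 2 ^ Suc k + 2 :: real"
  define T :: "'a node set" where "T = {q. ctr q \<in> K \<and>
    body q \<subseteq> souslin_part C (pre q) \<inter> K \<inter> cball (ctr q) (dyad (lvl q)) \<and>
    ?low (lvl q) \<le> sigma_content k (body q)}"
  define A where "A = souslin_part C [] \<inter> K"
  \<comment> \<open>Otherwise every point of \<open>A\<close> would be exceptional, and
    \<open>A\<close> would be sigma-finite.\<close>
  obtain x n where x: "x \<in> A" "?low n \<le> sigma_content k (A \<inter> cball x (dyad n))"
  proof -
    let ?Z = "{x \<in> A. \<not> (\<forall>m. \<exists>n\<ge>m. ?low n \<le> sigma_content k (A \<inter> cball x (dyad n)))}"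
    have "hausdorff_sigma_finite k ?Z"
      by (rule sigma_finite_low_density[OF K _ k]) (simp add: A_def)
    then have "\<not> A \<subseteq> ?Z"
      using nsf hausdorff_sigma_finite_subset unfolding A_def by blast
    then show ?thesis using that by blast
  qed
  define root where "root = Node [] (A \<inter> cball x (dyad n)) x n"
  have root: "root \<in> T" using x unfolding T_def root_def A_def by auto
  define Ch where "Ch q X \<longleftrightarrow> finite X \<and>
    (\<forall>p\<in>X. p \<in> T \<and> body p \<subseteq> body q \<and> lvl q < lvl p \<and> (\<exists>i. pre p = pre q @ [i])) \<and>
    (\<Sum>p\<in>X. dyad (lvl p) ^ k) = dyad (lvl q) ^ k \<and>
    (\<forall>p\<in>X. \<forall>p'\<in>X. p \<noteq> p' \<longrightarrow>
      (2 ^ Suc (length (pre q)) + 2) * dyad (lvl p) \<le> dist (ctr p) (ctr p')) \<and>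
    (\<forall>z\<in>K. \<forall>m. (\<Sum>p | p \<in> X \<and> m \<le> lvl p \<and> dist (ctr p) z < dyad m. dyad (lvl p) ^ k)
      \<le> ?L * dyad m ^ k)" for q X
  have "\<exists>X. Ch q X" if q: "q \<in> T" for q
  proof -
    let ?A' = "\<lambda>i. body q \<inter> souslin_part C (pre q @ [i])"
    let ?M = "2 ^ Suc (length (pre q)) + 2 :: real"
    have qT: "body q \<subseteq> souslin_part C (pre q)" "body q \<subseteq> K" "?low (lvl q) \<le> sigma_content k (body q)"
      using q unfolding T_def by auto
    have eq: "body q = (\<Union>i. ?A' i)" using qT(1) unfolding souslin_part_append[of C "pre q"] by blast
    have M: "0 < ?M" by (simp add: add_pos_pos)
    obtain I where I: "finite I" "(\<Sum>p\<in>I. dyad (snd p) ^ k) = dyad (lvl q) ^ k"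
      "\<And>p. p \<in> I \<Longrightarrow> fst p \<in> body q \<and> lvl q < snd p \<and>
         (\<exists>i. ?low (snd p) \<le> sigma_content k (?A' i \<inter> cball (fst p) (dyad (snd p))))"
      "\<And>p p'. p \<in> I \<Longrightarrow> p' \<in> I \<Longrightarrow> p \<noteq> p' \<Longrightarrow> ?M * dyad (snd p) \<le> dist (fst p) (fst p')"
      "\<And>m z. z \<in> K \<Longrightarrow> (\<Sum>p | p \<in> I \<and> m \<le> snd p \<and> dist (fst p) z < dyad m. dyad (snd p) ^ k)
         \<le> ?L * dyad m ^ k"
      by (rule packing_step[OF K qT(2) eq k M qT(3)], rule that)
    have "\<forall>p\<in>I. \<exists>i. ?low (snd p) \<le> sigma_content k (?A' i \<inter> cball (fst p) (dyad (snd p)))"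
      using I(3) by blast
    from bchoice[OF this] obtain i where i: "\<forall>p\<in>I.
        ?low (snd p) \<le> sigma_content k (?A' (i p) \<inter> cball (fst p) (dyad (snd p)))"
      by (elim exE)
    define N where "N p = Node (pre q @ [i p]) (?A' (i p) \<inter> cball (fst p) (dyad (snd p))) (fst p) (snd p)"
      for p
    have N [simp]: "pre (N p) = pre q @ [i p]" "ctr (N p) = fst p" "lvl (N p) = snd p"
      "body (N p) = ?A' (i p) \<inter> cball (fst p) (dyad (snd p))" for p
      unfolding N_def by simp_all
    have inj: "inj_on N Z" for Z
      by (rule inj_onI) (metis N(2,3) prod_eqI)
    have "Ch q (N ` I)"
      unfolding Ch_def
    proof (intro conjI ballI allI impI)
      show "finite (N ` I)" using I(1) by simp
      fix p assume "p \<in> N ` I"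
      then obtain r where r: "r \<in> I" "p = N r" by blast
      show "p \<in> T"
        unfolding T_def using r bspec[OF i r(1)] I(3)[OF r(1)] qT(2) by auto
      show "body p \<subseteq> body q" "lvl q < lvl p" "\<exists>i. pre p = pre q @ [i]"
        using r I(3)[OF r(1)] by auto
    next
      show "(\<Sum>p\<in>N ` I. dyad (lvl p) ^ k) = dyad (lvl q) ^ k"
        using I(2) by (simp add: sum.reindex[OF inj])
    next
      fix p p' assume "p \<in> N ` I" "p' \<in> N ` I" "p \<noteq> p'"
      then obtain r r' where "r \<in> I" "p = N r" "r' \<in> I" "p' = N r'" "r \<noteq> r'" by blast
      then show "?M * dyad (lvl p) \<le> dist (ctr p) (ctr p')" using I(4) by simp
    next
      fix z m assume z: "z \<in> K"
      have "{p. p \<in> N ` I \<and> m \<le> lvl p \<and> dist (ctr p) z < dyad m} =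
          N ` {p. p \<in> I \<and> m \<le> snd p \<and> dist (fst p) z < dyad m}" by auto
      then show "(\<Sum>p | p \<in> N ` I \<and> m \<le> lvl p \<and> dist (ctr p) z < dyad m. dyad (lvl p) ^ k)
          \<le> ?L * dyad m ^ k"
        using I(5)[OF z, of m] by (simp add: sum.reindex[OF inj])
    qed
    then show ?thesis by blast
  qed
  then obtain ch where ch: "\<And>q. q \<in> T \<Longrightarrow> Ch q (ch q)" by metis
  have "cantor_tree k ?L K T root ch"
  proof
    show "1 \<le> ?L" by (simp add: add_increasing)
    show "pre root = []" by (simp add: root_def)
    fix q assume q: "q \<in> T"
    have "0 < ?low (lvl q)" by simp
    also have "\<dots> \<le> sigma_content k (body q)" using q unfolding T_def by blast
    finally show "body q \<noteq> {}" using sigma_content_le_weight[of k "body q"] by auto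
    show "body q \<subseteq> K" "body q \<subseteq> cball (ctr q) (dyad (lvl q))" "ctr q \<in> K"
      using q unfolding T_def by auto
    note c = ch[OF q, unfolded Ch_def]
    show "finite (ch q)" "(\<Sum>p\<in>ch q. dyad (lvl p) ^ k) = dyad (lvl q) ^ k" using c by blast+
    show "p \<in> T" "body p \<subseteq> body q" "lvl q < lvl p" "\<exists>i. pre p = pre q @ [i]" if "p \<in> ch q" for p
      using c that by blast+
    show "(2 ^ Suc (length (pre q)) + 2) * dyad (lvl p) \<le> dist (ctr p) (ctr p')"
      if "p \<in> ch q" "p' \<in> ch q" "p \<noteq> p'" for p p'
      using c that by blast
    show "(\<Sum>p | p \<in> ch q \<and> m \<le> lvl p \<and> dist (ctr p) z < dyad m. dyad (lvl p) ^ k) \<le> ?L * dyad m ^ k"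
      if "z \<in> K" for z m
      using c that by blast
  qed (use k K root in auto)
  then show ?thesis
    by (rule that) (auto simp: T_def)
qed

theorem mainTheorem3:
  fixes E :: "'a::metric_space set"
  assumes "sigma_compact (UNIV :: 'a set)"
    and "doubling_space TYPE('a)"
    and "souslin E"
    and "\<not> hausdorff_sigma_finite CARD('n::finite) E"
  shows "\<exists>F. F \<subseteq> E \<and> closed F \<and>
           0 < hausdorff_measure CARD('n) F \<and> hausdorff_measure CARD('n) F < \<infinity> \<and>
           purely_unrectifiable TYPE('n) F"
proof -
  obtain C :: "nat list \<Rightarrow> 'a set" where C: "\<And>s. closed (C s)" and E: "E = souslin_part C []"
    using assms(3) unfolding souslin_def souslin_part_Nil by blast
  obtain K :: "nat \<Rightarrow> 'a set" where K: "\<And>i. compact (K i)" "UNIV = (\<Union>i. K i)"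
    using assms(1) unfolding sigma_compact_def by blast
  \<comment> \<open>Sigma-finiteness is stable under countable unions, so it fails on some compact
    piece; the covering and compactness arguments all take place there.\<close>
  obtain i where i: "\<not> hausdorff_sigma_finite CARD('n) (E \<inter> K i)"
  proof -
    have "E \<subseteq> (\<Union>i. E \<inter> K i)" using K(2) by blast
    then show ?thesis using hausdorff_sigma_finite_subset_UN assms(4) that by blast
  qed
  obtain T root ch where tree: "cantor_tree CARD('n) (12 ^ CARD('n) * 2 ^ Suc CARD('n) + 2) (K i) T root ch"
    and body: "\<And>q. q \<in> T \<Longrightarrow> body q \<subseteq> souslin_part C (pre q)"
    using souslin_not_sigma_finite_has_cantor_tree[OF _ K(1) i[unfolded E]] zero_less_card_finite by metis
  interpret cantor_tree "CARD('n)" "12 ^ CARD('n) * 2 ^ Suc CARD('n) + 2" "K i" T root ch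
    by (rule tree)
  have "cantor_set \<subseteq> E"
  proof
    fix z assume "z \<in> cantor_set"
    then obtain \<sigma> where \<sigma>: "\<And>n. \<exists>p\<in>T. pre p = map \<sigma> [0..<n] \<and> z \<in> closure (body p)"
      using cantor_set_branch by blast
    \<comment> \<open>Taking closures may lead out of the Souslin pieces, but not out of the closed
      sets \<open>C\<close>.\<close>
    have "z \<in> C (map \<sigma> [0..<Suc n])" for n
    proof -
      obtain p where p: "p \<in> T" "pre p = map \<sigma> [0..<Suc n]" "z \<in> closure (body p)" using \<sigma> by blast
      have "body p \<subseteq> C (map \<sigma> [0..<Suc n])"
        using body[OF p(1)] souslin_part_subset[of "pre p" C] p(2) by auto
      then have "closure (body p) \<subseteq> C (map \<sigma> [0..<Suc n])" using C by (rule closure_minimal)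
      then show ?thesis using p(3) by blast
    qed
    then show "z \<in> E" unfolding E souslin_part_Nil by blast
  qed
  then show ?thesis
    using closed_cantor_set hausdorff_measure_cantor_set_pos hausdorff_measure_cantor_set_finite
      purely_unrectifiable_cantor_set[OF refl] by blast
qed

end
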